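(* (Casselman–Shalika) For $\lambda\in(\mathfrak{a}_{\mathbb{Z}}^* )^+$ let $s_\lambda\in\mathbb{K}[X]^{W_0}\subseteq H$ be the Weyl character, and for $\mu\in\mathfrak{a}_{\mathbb{Z}}^*$ let $A_\mu=\varepsilon_0X^\mu\mathbf{1}_0\in\varepsilon_0H\mathbf{1}_0$, where $H$ is the affine Hecke algebra. Then, for all $\lambda\in(\mathfrak{a}_{\mathbb{Z}}^* )^+$, $$s_\lambda A_\rho=A_{\lambda+\rho}.$$
   Context: Setting. $G$ is a (complex, connected) reductive algebraic group with maximal torus $T$ and Borel subgroup $B\supseteq T$; $\mathfrak{a}_{\mathbb{Z}}^*=\mathrm{Hom}(T,\mathbb{C}^\times)$ is the weight lattice; $W_0=N(T)/T$ is the finite Weyl group, generated by simple reflections $s_1,\dots,s_n$, with length function $\ell(\cdot)$ and longest element $w_0$; $R^+$ is the set of positive roots; $\alpha_i$ and $\alpha_i^\vee$ ($i=1,\dots,n$) are the simple roots and coroots; $\mathring{\mathfrak{g}}$ is the Lie algebra of $G$. The element $\rho=\frac12\sum_{\alpha\in R^+}\alpha$ is assumed to lie in $\mathfrak{a}_{\mathbb{Z}}^*$. The dot action is $w\circ\lambda=w(\lambda+\rho)-\rho$, and $(\mathfrak{a}_{\mathbb{Z}}^* )^+=\{\lambda\in\mathfrak{a}_{\mathbb{Z}}^*\mid\langle\lambda+\rho,\alpha_i^\vee\rangle>0\text{ for }i=1,\dots,n\}$ is the set of dominant integral weights. Affine Hecke algebra. Let $\mathbb{K}=\mathbb{Z}[t^{\frac12},t^{-\frac12}]$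 and let $m_{ij}$ be the order of $s_is_j$ in $W_0$. $H$ is the $\mathbb{K}$-algebra with $\mathbb{K}$-basis $\{X^\mu T_w\mid\mu\in\mathfrak{a}_{\mathbb{Z}}^*,w\in W_0\}$ (where $T_w=T_{s_{i_1}}\cdots T_{s_{i_k}}$ for a reduced word $w=s_{i_1}\cdots s_{i_k}$) and relations $$(T_{s_i}-t^{\frac12})(T_{s_i}+t^{-\frac12})=0,\qquad \underbrace{T_{s_i}T_{s_j}T_{s_i}\cdots}_{m_{ij}\text{ factors}}=\underbrace{T_{s_j}T_{s_i}T_{s_j}\cdots}_{m_{ij}\text{ factors}},$$ $$X^{\lambda+\mu}=X^\lambda X^\mu,\qquad T_{s_i}X^\lambda-X^{s_i\lambda}T_{s_i}=(t^{\frac12}-t^{-\frac12})\frac{X^\lambda-X^{s_i\lambda}}{1-X^{-\alpha_i}},$$ for $i,j\in\{1,\dots,n\}$, $i\ne j$, and $\lambda,\mu\in\mathfrak{a}_{\mathbb{Z}}^*$. The subalgebra $\mathbb{K}[X]$ spanned by the $X^\mu$ is the group algebra of $\mathfrak{a}_{\mathbb{Z}}^*$, with $W_0$-action $wX^\mu=X^{w\mu}$; by a theorem of Bernstein the center of $H$ is $\mathbb{K}[X]^{W_0}$. In particular $\mathbb{K}[X]^{W_0}$ acts on $\varepsilon_0H\mathbf{1}_0$ by left multiplication, where $$\varepsilon_0=(-t^{\frac12})^{\ell(w_0)}\sum_{z\in W_0}(-t^{-\frac12})^{\ell(z)}T_z,\qquad \mathbf{1}_0=(t^{-\frac12})^{\ell(w_0)}\sum_{z\in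 W_0}(t^{\frac12})^{\ell(z)}T_z .$$ Weyl characters. For $\lambda\in(\mathfrak{a}_{\mathbb{Z}}^* )^+$, $$s_\lambda=\mathrm{char}(L_{\mathring{\mathfrak{g}}}(\lambda))=\frac{\sum_{w\in W_0}\det(w)X^{w\circ\lambda}}{\sum_{w\in W_0}\det(w)X^{w\circ0}}\in\mathbb{K}[X]^{W_0},$$ where $L_{\mathring{\mathfrak{g}}}(\lambda)$ is the irreducible $\mathring{\mathfrak{g}}$-module of highest weight $\lambda$. *)

theory Defs
  imports "HOL-Library.Poly_Mapping" "Jordan_Normal_Form.Determinant"
begin

section \<open>Lattices as modules over the integers\<close>

definition zmul :: "int \<Rightarrow> 'a::ab_group_add \<Rightarrow> 'a" where
  "zmul k x = (\<Sum>i<nat k. x) - (\<Sum>i<nat (- k). x)"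

lemma zmul_diff_nat: "zmul (int m - int n) x = (\<Sum>i<m. x) - (\<Sum>i<n. x)"
proof -
  have add: "(\<Sum>i<a + b. x) = (\<Sum>i<a. x) + (\<Sum>i<b. x)" for a b :: nat
    by (induction b) (simp_all add: add.assoc)
  show ?thesis
  proof (cases "n \<le> m")
    case True
    then obtain k where "m = n + k" using le_Suc_ex by blast
    then show ?thesis by (simp add: zmul_def add)
  next
    case False
    then obtain k where "n = m + k" using le_Suc_ex nat_le_linear by blast
    then show ?thesis by (simp add: zmul_def add)
  qed
qed

interpretation zmod: Modules.module "zmul :: int \<Rightarrow> 'a::ab_group_add \<Rightarrow> 'a"
proof
  have sum_add: "(\<Sum>i<a + b. x) = (\<Sum>i<a. x) + (\<Sum>i<b. x)" for a b :: nat and x :: 'a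
    by (induction b) (simp_all add: add.assoc)
  have sum_mult: "(\<Sum>i<a * b. x) = (\<Sum>i<a. \<Sum>j<b. x)" for a b :: nat and x :: 'a
    by (induction a) (simp_all add: sum_add add.commute)
  fix a b :: int and x y :: 'a
  obtain m n where a: "a = int m - int n" by (rule int_diff_cases)
  obtain p q where b: "b = int p - int q" by (rule int_diff_cases)
  show "zmul a (x + y) = zmul a x + zmul a y"
    by (simp add: a zmul_diff_nat sum.distrib)
  have "a + b = int (m + p) - int (n + q)" by (simp add: a b)
  then have "zmul (a + b) x = (\<Sum>i<m + p. x) - (\<Sum>i<n + q. x)"
    by (simp only: zmul_diff_nat)
  then show "zmul (a + b) x = zmul a x + zmul b x"
    by (simp add: a b zmul_diff_nat sum_add)
  have "a * b = int (m * p + n * q) - int (m * q + n * p)"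
    by (simp add: a b algebra_simps)
  then have "zmul (a * b) x = (\<Sum>i<m * p + n * q. x) - (\<Sum>i<m * q + n * p. x)"
    by (simp only: zmul_diff_nat)
  then show "zmul a (zmul b x) = zmul (a * b) x"
    by (simp add: a b zmul_diff_nat sum_add sum_mult sum_subtractf)
  show "zmul 1 x = x" by (simp add: zmul_def)
qed

definition lattice_basis :: "'a::ab_group_add list \<Rightarrow> bool" where
  "lattice_basis bs \<longleftrightarrow>
     distinct bs \<and> zmod.independent (set bs) \<and> zmod.span (set bs) = UNIV"

text \<open>Only meaningful for an additive endomorphism of a lattice, for which it does not depend on
  the chosen basis.\<close>

definition lattice_det :: "('a::ab_group_add \<Rightarrow> 'a) \<Rightarrow> int" where
  "lattice_det f = (let bs = (SOME bs. lattice_basis bs); r = length bs in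
     det (mat r r (\<lambda>(i, j). zmod.representation (set bs) (f (bs ! j)) (bs ! i))))"

section \<open>Based root data\<close>

text \<open>
  A complex connected reductive group with a maximal torus and a Borel subgroup containing it is
  recorded by its based root datum: the type \<open>'x\<close> is the weight lattice (the characters of the
  torus), \<open>'y\<close> the cocharacter lattice, and the Borel subgroup corresponds to the choice of the
  simple roots \<open>simple_root D 1, \<dots>, simple_root D (num_simple D)\<close>.
\<close>

record ('x, 'y) root_datum =
  pairing :: "'x \<Rightarrow> 'y \<Rightarrow> int"
  roots :: "'x set"
  coroot :: "'x \<Rightarrow> 'y"
  num_simple :: nat
  simple_root :: "nat \<Rightarrow> 'x"

definition reflection :: "('x::ab_group_add, 'y::ab_group_add) root_datum \<Rightarrow> 'x \<Rightarrow> 'x \<Rightarrow> 'x" where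
  "reflection D \<alpha> x = x - zmul (pairing D x (coroot D \<alpha>)) \<alpha>"

definition coreflection :: "('x::ab_group_add, 'y::ab_group_add) root_datum \<Rightarrow> 'x \<Rightarrow> 'y \<Rightarrow> 'y" where
  "coreflection D \<alpha> y = y - zmul (pairing D \<alpha> y) (coroot D \<alpha>)"

definition positive_roots :: "('x::ab_group_add, 'y::ab_group_add) root_datum \<Rightarrow> 'x set" where
  "positive_roots D = {\<beta> \<in> roots D. \<exists>c. (\<forall>i. c i \<ge> 0) \<and>
     \<beta> = (\<Sum>i=1..num_simple D. zmul (c i) (simple_root D i))}"

locale based_root_datum =
  fixes D :: "('x::ab_group_add, 'y::ab_group_add) root_datum"
  assumes lattice: "\<exists>bs :: 'x list. lattice_basis bs"
    and pairing_add_left: "pairing D (x + x') y = pairing D x y + pairing D x' y"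
    and pairing_add_right: "pairing D x (y + y') = pairing D x y + pairing D x y'"
    and perfect_left: "(\<And>x x'. f (x + x') = f x + f x') \<Longrightarrow> \<exists>!y. \<forall>x. f x = pairing D x y"
    and perfect_right: "(\<And>y y'. g (y + y') = g y + g y') \<Longrightarrow> \<exists>!x. \<forall>y. g y = pairing D x y"
    and finite_roots: "finite (roots D)"
    and inj_coroot: "inj_on (coroot D) (roots D)"
    and pairing_root_coroot: "\<alpha> \<in> roots D \<Longrightarrow> pairing D \<alpha> (coroot D \<alpha>) = 2"
    and reflection_roots: "\<alpha> \<in> roots D \<Longrightarrow> reflection D \<alpha> ` roots D = roots D"
    and coreflection_coroots:
      "\<alpha> \<in> roots D \<Longrightarrow> coreflection D \<alpha> ` coroot D ` roots D = coroot D ` roots D"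
    and reduced: "\<alpha> \<in> roots D \<Longrightarrow> \<alpha> + \<alpha> \<notin> roots D"
    and simple_roots: "simple_root D ` {1..num_simple D} \<subseteq> roots D"
    and inj_simple_root: "inj_on (simple_root D) {1..num_simple D}"
    and independent_simple_roots: "zmod.independent (simple_root D ` {1..num_simple D})"
    and roots_pos_or_neg: "\<beta> \<in> roots D \<Longrightarrow> \<beta> \<in> positive_roots D \<or> - \<beta> \<in> positive_roots D"

text \<open>Determined uniquely whenever it exists, since the weight lattice is torsion free.\<close>

definition rho :: "('x::ab_group_add, 'y::ab_group_add) root_datum \<Rightarrow> 'x" where
  "rho D = (THE \<rho>. \<rho> + \<rho> = \<Sum>(positive_roots D))"

section \<open>The finite Weyl group\<close>

definition simple_reflection ::
  "('x::ab_group_add, 'y::ab_group_add) root_datum \<Rightarrow> nat \<Rightarrow> 'x \<Rightarrow> 'x" where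
  "simple_reflection D i = reflection D (simple_root D i)"

definition word_action ::
  "('x::ab_group_add, 'y::ab_group_add) root_datum \<Rightarrow> nat list \<Rightarrow> 'x \<Rightarrow> 'x" where
  "word_action D is = foldr (\<lambda>i f. simple_reflection D i \<circ> f) is id"

text \<open>The group generated by the simple reflections; no inverses are needed since these are
  involutions.\<close>

definition weyl_group :: "('x::ab_group_add, 'y::ab_group_add) root_datum \<Rightarrow> ('x \<Rightarrow> 'x) set" where
  "weyl_group D = word_action D ` lists {1..num_simple D}"

definition weyl_length ::
  "('x::ab_group_add, 'y::ab_group_add) root_datum \<Rightarrow> ('x \<Rightarrow> 'x) \<Rightarrow> nat" where
  "weyl_length D w =
     (LEAST k. \<exists>is \<in> lists {1..num_simple D}. word_action D is = w \<and> length is = k)"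

definition reduced_word ::
  "('x::ab_group_add, 'y::ab_group_add) root_datum \<Rightarrow> ('x \<Rightarrow> 'x) \<Rightarrow> nat list \<Rightarrow> bool" where
  "reduced_word D w is \<longleftrightarrow>
     is \<in> lists {1..num_simple D} \<and> word_action D is = w \<and> length is = weyl_length D w"

definition longest_element :: "('x::ab_group_add, 'y::ab_group_add) root_datum \<Rightarrow> 'x \<Rightarrow> 'x" where
  "longest_element D =
     (THE w. w \<in> weyl_group D \<and> (\<forall>v \<in> weyl_group D. weyl_length D v \<le> weyl_length D w))"

definition coxeter_order ::
  "('x::ab_group_add, 'y::ab_group_add) root_datum \<Rightarrow> nat \<Rightarrow> nat \<Rightarrow> nat" where
  "coxeter_order D i j =
     (LEAST m. m > 0 \<and> (simple_reflection D i \<circ> simple_reflection D j) ^^ m = id)"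

definition dot_action ::
  "('x::ab_group_add, 'y::ab_group_add) root_datum \<Rightarrow> ('x \<Rightarrow> 'x) \<Rightarrow> 'x \<Rightarrow> 'x" where
  "dot_action D w lam = w (lam + rho D) - rho D"

definition dominant_weights :: "('x::ab_group_add, 'y::ab_group_add) root_datum \<Rightarrow> 'x set" where
  "dominant_weights D =
     {lam. \<forall>i \<in> {1..num_simple D}. pairing D (lam + rho D) (coroot D (simple_root D i)) > 0}"

section \<open>The group algebra of the weight lattice and Weyl characters\<close>

text \<open>Laurent polynomials with integer coefficients in the square root of \<open>t\<close>: the exponent \<open>k\<close> of
  the finitely supported function stands for \<open>t\<close> to the power \<open>k/2\<close>. The product of \<open>\<Rightarrow>\<^sub>0\<close> is
  convolution.\<close>

type_synonym laurent = "int \<Rightarrow>\<^sub>0 int"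

definition t_half :: laurent where "t_half = Poly_Mapping.single 1 1"

definition t_neg_half :: laurent where "t_neg_half = Poly_Mapping.single (- 1) 1"

type_synonym 'x group_alg = "'x \<Rightarrow>\<^sub>0 laurent"

definition Xmon :: "'x \<Rightarrow> 'x group_alg" where
  "Xmon \<mu> = Poly_Mapping.single \<mu> 1"

text \<open>The exact quotient in the group algebra, which is an integral domain when the exponents form a
  lattice.\<close>

definition exact_quotient ::
  "'x::ab_group_add group_alg \<Rightarrow> 'x group_alg \<Rightarrow> 'x group_alg" where
  "exact_quotient f g = (THE q. q * g = f)"

definition weyl_numerator ::
  "('x::ab_group_add, 'y::ab_group_add) root_datum \<Rightarrow> 'x \<Rightarrow> 'x group_alg" where
  "weyl_numerator D lam =
     (\<Sum>w \<in> weyl_group D. of_int (lattice_det w) * Xmon (dot_action D w lam))"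

definition weyl_character ::
  "('x::ab_group_add, 'y::ab_group_add) root_datum \<Rightarrow> 'x \<Rightarrow> 'x group_alg" where
  "weyl_character D lam = exact_quotient (weyl_numerator D lam) (weyl_numerator D 0)"

section \<open>The affine Hecke algebra\<close>

record ('x, 'h) hecke_data =
  scale :: "laurent \<Rightarrow> 'h \<Rightarrow> 'h"
  X_elt :: "'x \<Rightarrow> 'h"
  T_gen :: "nat \<Rightarrow> 'h"

definition T_elt ::
  "('x::ab_group_add, 'y::ab_group_add) root_datum \<Rightarrow> ('x, 'h::ring_1) hecke_data
     \<Rightarrow> ('x \<Rightarrow> 'x) \<Rightarrow> 'h" where
  "T_elt D H w = prod_list (map (T_gen H) (SOME is. reduced_word D w is))"

definition group_alg_embed ::
  "('x::ab_group_add, 'h::ring_1) hecke_data \<Rightarrow> 'x group_alg \<Rightarrow> 'h" where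
  "group_alg_embed H f =
     (\<Sum>\<mu> \<in> Poly_Mapping.keys f. scale H (Poly_Mapping.lookup f \<mu>) (X_elt H \<mu>))"

text \<open>The product \<open>a * b * a * \<dots>\<close> with \<open>m\<close> factors.\<close>

definition alternating_prod :: "nat \<Rightarrow> 'h::ring_1 \<Rightarrow> 'h \<Rightarrow> 'h" where
  "alternating_prod m a b = prod_list (map (\<lambda>k. if even k then a else b) [0..<m])"

locale affine_hecke_algebra =
  based_root_datum D + Modules.module "scale H"
  for D :: "('x::ab_group_add, 'y::ab_group_add) root_datum"
    and H :: "('x, 'h::ring_1) hecke_data" +
  assumes scale_mult_left: "scale H a (x * y) = scale H a x * y"
    and scale_mult_right: "scale H a (x * y) = x * scale H a y"
    and quadratic: "i \<in> {1..num_simple D} \<Longrightarrow>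
      (T_gen H i - scale H t_half 1) * (T_gen H i + scale H t_neg_half 1) = 0"
    and braid: "\<lbrakk>i \<in> {1..num_simple D}; j \<in> {1..num_simple D}; i \<noteq> j\<rbrakk> \<Longrightarrow>
      alternating_prod (coxeter_order D i j) (T_gen H i) (T_gen H j) =
      alternating_prod (coxeter_order D i j) (T_gen H j) (T_gen H i)"
    and X_add: "X_elt H (lam + \<mu>) = X_elt H lam * X_elt H \<mu>"
    and bernstein: "i \<in> {1..num_simple D} \<Longrightarrow>
      T_gen H i * X_elt H lam - X_elt H (simple_reflection D i lam) * T_gen H i =
      scale H (t_half - t_neg_half)
        (group_alg_embed H
          (exact_quotient (Xmon lam - Xmon (simple_reflection D i lam))
                          (1 - Xmon (- simple_root D i))))"
    and basis_inj: "inj_on (\<lambda>(\<mu>, w). X_elt H \<mu> * T_elt D H w) (UNIV \<times> weyl_group D)"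
    and basis_independent:
      "independent ((\<lambda>(\<mu>, w). X_elt H \<mu> * T_elt D H w) ` (UNIV \<times> weyl_group D))"
    and basis_span:
      "span ((\<lambda>(\<mu>, w). X_elt H \<mu> * T_elt D H w) ` (UNIV \<times> weyl_group D)) = UNIV"

definition eps0 ::
  "('x::ab_group_add, 'y::ab_group_add) root_datum \<Rightarrow> ('x, 'h::ring_1) hecke_data \<Rightarrow> 'h" where
  "eps0 D H = scale H ((- t_half) ^ weyl_length D (longest_element D))
     (\<Sum>z \<in> weyl_group D. scale H ((- t_neg_half) ^ weyl_length D z) (T_elt D H z))"

definition one0 ::
  "('x::ab_group_add, 'y::ab_group_add) root_datum \<Rightarrow> ('x, 'h::ring_1) hecke_data \<Rightarrow> 'h" where
  "one0 D H = scale H (t_neg_half ^ weyl_length D (longest_element D))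
     (\<Sum>z \<in> weyl_group D. scale H (t_half ^ weyl_length D z) (T_elt D H z))"

definition A_elt ::
  "('x::ab_group_add, 'y::ab_group_add) root_datum \<Rightarrow> ('x, 'h::ring_1) hecke_data
     \<Rightarrow> 'x \<Rightarrow> 'h" where
  "A_elt D H \<mu> = eps0 D H * X_elt H \<mu> * one0 D H"

end

(*
  Write a_nu for the alternant, the sum over w of det(w) X^(w nu), so that the Weyl character s is
  characterised by s a_rho = a_(lam + rho). Such a W-invariant s exists by induction on the
  invariant norm of lam + rho: multiplying a_rho by the orbit sum of lam gives the sum of
  a_(mu + rho) over the orbit, where all terms with mu distinct from lam vanish or are, up to sign,
  alternants of dominant weights of smaller norm. It is unique because X^rho is the leading
  term of a_rho with respect to pairing with rho.

  The relation T_w T_i = T_(w s_i) for increasing length, which needs Matsumoto's theorem, makes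
  1_0 and eps_0 eigenvectors of T_i with eigenvalues t^(1/2) and -t^(-1/2). Since T_i commutes with
  X^mu + X^(s_i mu), both t^(1/2) and -t^(-1/2) times A_mu + A_(s_i mu) agree, hence
  A_(w mu) = det(w) A_mu. Therefore eps_0 a_nu 1_0 = |W| A_nu, and as s commutes with eps_0,
    |W| s A_rho = eps_0 s a_rho 1_0 = eps_0 a_(lam + rho) 1_0 = |W| A_(lam + rho);
  H is free over a domain of characteristic 0, so |W| cancels.
*)

theory Submission
  imports Defs
begin

text \<open>The Weyl group is given only by words in simple reflections of the weight lattice, and
  the Weyl character only as an exact quotient of two alternating sums. Lengths, finiteness and
  dominance all rest on one geometric fact: the only positive root that a simple reflection makes
  negative is its own simple root. The invariant form is built from the coroots; pairing with \<rho>
  in this form serves as a height, positive on every positive root. It supplies the leading terms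
  and also the descent of norms: for \<mu> in the orbit of lam, the norms of \<mu> + \<rho> and lam
  + \<rho> differ by twice the difference of the heights of \<mu> and lam.

  Of Bernstein's description of the center only one inclusion enters, that invariants commute with
  the T_i. It comes from a symmetry: the correction term of the Bernstein relation changes sign when
  \<mu> and s_i \<mu> are exchanged.\<close>

text \<open>All coordinates in the basis are multiplied by \<open>k\<close>, so they vanish. Over
  the integers this concerns the weight lattice; over the Laurent polynomials it cancels
  \<open>2\<close>, \<open>t_half + t_neg_half\<close> and the order of the Weyl group in
  \<open>H\<close>.\<close>

lemma (in Modules.module) torsion_free_if_basis:
  assumes "independent B" and "span B = UNIV"
    and "\<And>a. k * a = 0 \<Longrightarrow> a = 0" and "k *s x = 0"
  shows "x = 0"
proof -
  have "representation B (k *s x) = (\<lambda>b. k * representation B x b)"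
    by (rule representation_scale) (use assms in auto)
  then have "k * representation B x b = 0" for b
    using assms(4) by (metis representation_zero)
  then have "representation B x b = 0" for b
    using assms(3) by blast
  then show ?thesis
    using sum_nonzero_representation_eq[OF assms(1), of x] assms(2) by simp
qed

lemma additive_zmul:
  assumes "additive f"
  shows "f (zmul k x) = zmul k (f x)"
  by (simp only: zmul_def additive.diff[OF assms] additive.sum[OF assms])

lemma zmul_int [simp]: "zmul k (m :: int) = k * m"
  by (cases "k \<ge> 0") (simp_all add: zmul_def)

section \<open>First consequences of the root datum axioms\<close>

context based_root_datum
begin

text \<open>An opaque name for the index range: membership stays atomic instead of being rewritten
  to two inequalities.\<close>

definition index_set :: "nat set" where
  "index_set = {1..num_simple D}"

lemma finite_index_set [simp]: "finite index_set"
  by (simp add: index_set_def)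

lemma pairing_additive_left: "additive (\<lambda>x. pairing D x y)"
  by standard (rule pairing_add_left)

lemma pairing_additive_right: "additive (pairing D x)"
  by standard (rule pairing_add_right)

lemmas pairing_linear [simp] =
  additive.zero[OF pairing_additive_left] additive.minus[OF pairing_additive_left]
  additive.diff[OF pairing_additive_left] pairing_add_left
  additive_zmul[OF pairing_additive_left, unfolded zmul_int]
  additive.zero[OF pairing_additive_right] additive.minus[OF pairing_additive_right]
  additive.diff[OF pairing_additive_right] pairing_add_right
  additive_zmul[OF pairing_additive_right, unfolded zmul_int]

lemma lattice_torsion_free:
  fixes x :: 'x
  assumes "k \<noteq> 0" and "zmul k x = 0"
  shows "x = 0"
  using zmod.torsion_free_if_basis[of _ k x] lattice assms unfolding lattice_basis_def by auto

text \<open>Absence of 2-torsion makes the half sum of positive roots unique and lets identities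
  about \<rho> be checked after doubling.\<close>

lemma double_eq_iff:
  fixes x y :: 'x
  shows "x + x = y + y \<longleftrightarrow> x = y"
proof
  assume *: "x + x = y + y"
  have "zmul (1 + 1) (x - y) = (x - y) + (x - y)"
    by (simp only: zmod.scale_left_distrib zmod.scale_one)
  also have "\<dots> = 0"
    using * by (simp add: algebra_simps)
  finally have "x - y = 0"
    by (rule lattice_torsion_free[rotated]) simp
  then show "x = y" by simp
qed simp

lemma reflection_additive: "additive (reflection D \<alpha>)"
  by standard (simp add: reflection_def zmod.scale_left_distrib)

lemma reflection_root: "\<alpha> \<in> roots D \<Longrightarrow> reflection D \<alpha> \<alpha> = - \<alpha>"
proof -
  assume "\<alpha> \<in> roots D"
  moreover have "zmul (1 + 1) \<alpha> = \<alpha> + \<alpha>"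
    by (simp only: zmod.scale_left_distrib zmod.scale_one)
  ultimately show ?thesis
    by (simp add: reflection_def pairing_root_coroot)
qed

lemma reflection_involution: "\<alpha> \<in> roots D \<Longrightarrow> reflection D \<alpha> (reflection D \<alpha> x) = x"
  by (simp add: reflection_def pairing_root_coroot zmod.scale_left_diff_distrib algebra_simps
      flip: zmod.scale_left_distrib)

lemma root_neq_0: "\<alpha> \<in> roots D \<Longrightarrow> \<alpha> \<noteq> 0"
  using pairing_root_coroot by fastforce

lemma simple_root_in: "i \<in> index_set \<Longrightarrow> simple_root D i \<in> roots D"
  using simple_roots unfolding index_set_def by blast

section \<open>The invariant form\<close>

text \<open>The canonical invariant form of the root datum. It is only semidefinite: characters that
  pair to zero with every coroot are isotropic. On roots it is positive.\<close>

definition form :: "'x \<Rightarrow> 'x \<Rightarrow> int" where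
  "form x y = (\<Sum>\<beta>\<in>roots D. pairing D x (coroot D \<beta>) * pairing D y (coroot D \<beta>))"

lemma form_commute: "form x y = form y x"
  by (simp add: form_def mult.commute)

lemma form_additive_left: "additive (\<lambda>x. form x y)"
  by standard (simp add: form_def algebra_simps sum.distrib)

lemma form_additive_right: "additive (form x)"
  by standard (simp add: form_def algebra_simps sum.distrib)

lemmas form_linear [simp] =
  additive.zero[OF form_additive_left] additive.minus[OF form_additive_left]
  additive.diff[OF form_additive_left] additive.add[OF form_additive_left]
  additive_zmul[OF form_additive_left, unfolded zmul_int]
  additive.zero[OF form_additive_right] additive.minus[OF form_additive_right]
  additive.diff[OF form_additive_right] additive.add[OF form_additive_right]
  additive_zmul[OF form_additive_right, unfolded zmul_int]

lemma form_nonneg: "form x x \<ge> 0"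
  by (simp add: form_def sum_nonneg)

lemma form_root_pos: "\<alpha> \<in> roots D \<Longrightarrow> form \<alpha> \<alpha> > 0"
  unfolding form_def
  by (rule sum_pos2[OF finite_roots, of \<alpha>]) (simp_all add: pairing_root_coroot)

text \<open>Reflection and coreflection are adjoint for the pairing, so reflecting both arguments
  merely permutes the coroots in the sum.\<close>

lemma form_reflection:
  assumes "\<alpha> \<in> roots D"
  shows "form (reflection D \<alpha> x) (reflection D \<alpha> y) = form x y"
proof -
  let ?C = "coroot D ` roots D"
  define h where "h c = pairing D x c * pairing D y c" for c
  have adj: "pairing D (reflection D \<alpha> z) c = pairing D z (coreflection D \<alpha> c)" for z c
    by (simp add: reflection_def coreflection_def)
  have form_h: "form x y = sum h ?C"
    by (simp add: form_def h_def sum.reindex[OF inj_coroot])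
  have "form (reflection D \<alpha> x) (reflection D \<alpha> y) = (\<Sum>c\<in>?C. h (coreflection D \<alpha> c))"
    by (simp add: form_def h_def sum.reindex[OF inj_coroot] adj)
  \<comment> \<open>A map of the finite set of coroots onto itself is injective, so the sum may be
    reindexed.\<close>
  also have "\<dots> = sum h (coreflection D \<alpha> ` ?C)"
    using coreflection_coroots[OF assms] finite_roots
    by (subst sum.reindex) (auto intro!: eq_card_imp_inj_on)
  finally show ?thesis
    by (simp add: coreflection_coroots[OF assms] form_h)
qed

text \<open>The reflection is an isometry that negates \<alpha>; expanding this gives the usual 2(x,
  \<alpha>)/(\<alpha>, \<alpha>). Pairings with coroots thereby become expressions in the invariant
  form.\<close>

lemma form_root:
  assumes "\<alpha> \<in> roots D"
  shows "2 * form x \<alpha> = pairing D x (coroot D \<alpha>) * form \<alpha> \<alpha>"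
proof -
  have "form (reflection D \<alpha> x) (- \<alpha>) = form x \<alpha>"
    using form_reflection[OF assms, of x \<alpha>] by (simp add: reflection_root assms)
  then show ?thesis
    by (simp add: reflection_def)
qed

section \<open>Positive roots\<close>

lemma simple_root_coeffs_unique:
  assumes "(\<Sum>i\<in>index_set. zmul (c i) (simple_root D i)) =
           (\<Sum>i\<in>index_set. zmul (d i) (simple_root D i))"
    and "i \<in> index_set"
  shows "c i = d i"
proof -
  note inj = inj_simple_root[folded index_set_def]
  \<comment> \<open>Independence speaks of coefficient functions on vectors, while the coefficients
    here are indexed by numbers.\<close>
  let ?inv = "the_inv_into index_set (simple_root D)"
  define u where "u v = c (?inv v) - d (?inv v)" for v
  have "(\<Sum>v\<in>simple_root D ` index_set. zmul (u v) v) =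
      (\<Sum>i\<in>index_set. zmul (c i - d i) (simple_root D i))"
    by (simp add: sum.reindex[OF inj] u_def the_inv_into_f_f[OF inj])
  also have "\<dots> = 0"
    using assms(1) by (simp add: zmod.scale_left_diff_distrib sum_subtractf)
  finally have "u (simple_root D i) = 0"
    using zmod.independentD[OF independent_simple_roots[folded index_set_def], of "simple_root D ` index_set" u] assms(2)
    by simp
  then show ?thesis
    using assms(2) by (simp add: u_def the_inv_into_f_f[OF inj])
qed

lemma positive_rootE:
  assumes "\<beta> \<in> positive_roots D"
  obtains c where "\<And>i. c i \<ge> 0" "\<beta> = (\<Sum>i\<in>index_set. zmul (c i) (simple_root D i))" "\<beta> \<in> roots D"
  using assms unfolding positive_roots_def index_set_def by blast

lemma finite_positive_roots: "finite (positive_roots D)"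
  using finite_roots unfolding positive_roots_def by simp

text \<open>Two nonnegative coefficient vectors that are negatives of each other are zero, and a
  root is nonzero.\<close>

lemma uminus_positive_root:
  assumes "\<beta> \<in> positive_roots D"
  shows "- \<beta> \<notin> positive_roots D"
proof
  assume "- \<beta> \<in> positive_roots D"
  then obtain d where d: "\<And>i. d i \<ge> (0::int)"
      "- \<beta> = (\<Sum>i\<in>index_set. zmul (d i) (simple_root D i))"
    by (rule positive_rootE) blast
  obtain c where c: "\<And>i. c i \<ge> (0::int)" "\<beta> = (\<Sum>i\<in>index_set. zmul (c i) (simple_root D i))"
      "\<beta> \<in> roots D"
    using assms by (rule positive_rootE) blast
  have "\<beta> = (\<Sum>i\<in>index_set. zmul (- d i) (simple_root D i))"
    using d(2) by (simp add: sum_negf) (metis minus_minus)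
  then have "c i = - d i" if "i \<in> index_set" for i
    using simple_root_coeffs_unique[of c "\<lambda>i. - d i"] c(2) that by simp
  then have "c i = 0" if "i \<in> index_set" for i
    using c(1)[of i] d(1)[of i] that by fastforce
  then have "\<beta> = 0"
    using c(2) by simp
  then show False
    using root_neq_0 c(3) by blast
qed

lemma simple_root_as_sum:
  assumes "i \<in> index_set"
  shows "(\<Sum>j\<in>index_set. zmul (if j = i then n else 0) (simple_root D j)) = zmul n (simple_root D i)"
proof -
  have "(\<Sum>j\<in>index_set. zmul (if j = i then n else 0) (simple_root D j)) =
      (\<Sum>j\<in>index_set. if j = i then zmul n (simple_root D j) else 0)"
    by (intro sum.cong) simp_all
  then show ?thesis using assms by simp
qed

lemma simple_root_positive:
  assumes "i \<in> index_set"
  shows "simple_root D i \<in> positive_roots D"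
  unfolding positive_roots_def index_set_def[symmetric]
  using simple_root_as_sum[OF assms, of 1] simple_root_in[OF assms]
  by (auto intro!: exI[of _ "\<lambda>j. if j = i then 1 else 0 :: int"])

text \<open>The reflection changes only the coefficient of its own simple root. A negative image
  would thus force all other coefficients to vanish, so that \<beta> would be a multiple of that
  simple root, which reducedness excludes.\<close>

lemma simple_reflection_positive:
  assumes i: "i \<in> index_set" and "\<beta> \<in> positive_roots D" and ne: "\<beta> \<noteq> simple_root D i"
  shows "simple_reflection D i \<beta> \<in> positive_roots D"
proof (rule ccontr)
  let ?\<alpha> = "simple_root D i" and ?n = "pairing D \<beta> (coroot D (simple_root D i))"
  obtain c where c: "\<And>i. c i \<ge> (0::int)" "\<beta> = (\<Sum>i\<in>index_set. zmul (c i) (simple_root D i))"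
      "\<beta> \<in> roots D"
    using assms(2) by (rule positive_rootE) blast
  have refl: "simple_reflection D i \<beta> = \<beta> - zmul ?n ?\<alpha>"
    by (simp add: simple_reflection_def reflection_def)
  have "simple_reflection D i \<beta> \<in> roots D"
    using reflection_roots[OF simple_root_in[OF i]] c(3) unfolding simple_reflection_def by blast
  moreover assume "simple_reflection D i \<beta> \<notin> positive_roots D"
  ultimately obtain d where d: "\<And>i. d i \<ge> (0::int)"
      "- simple_reflection D i \<beta> = (\<Sum>i\<in>index_set. zmul (d i) (simple_root D i))"
    using roots_pos_or_neg positive_rootE by metis
  have "(\<Sum>j\<in>index_set. zmul (c j - (if j = i then ?n else 0)) (simple_root D j)) = \<beta> - zmul ?n ?\<alpha>"
    by (simp only: zmod.scale_left_diff_distrib sum_subtractf simple_root_as_sum[OF i] flip: c(2))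
  also have "\<dots> = (\<Sum>j\<in>index_set. zmul (- d j) (simple_root D j))"
    using d(2) by (simp only: refl sum_negf zmod.scale_minus_left flip: d(2)) simp
  finally have eq: "(\<Sum>j\<in>index_set. zmul (c j - (if j = i then ?n else 0)) (simple_root D j)) =
      (\<Sum>j\<in>index_set. zmul (- d j) (simple_root D j))" .
  have "c j - (if j = i then ?n else 0) = - d j" if "j \<in> index_set" for j
    using simple_root_coeffs_unique[OF eq that] .
  then have "c j = 0" if "j \<in> index_set" "j \<noteq> i" for j
    using c(1)[of j] d(1)[of j] that by fastforce
  then have "\<beta> = (\<Sum>j\<in>index_set. zmul (if j = i then c i else 0) (simple_root D j))"
    unfolding c(2) by (intro sum.cong) simp_all
  then have \<beta>: "\<beta> = zmul (c i) ?\<alpha>"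
    using simple_root_as_sum[OF i, of "c i"] by simp
  \<comment> \<open>Pairing \<beta> with its own coroot bounds the multiple: it divides 2.\<close>
  have "c i * pairing D ?\<alpha> (coroot D \<beta>) = 2"
    using pairing_root_coroot[OF c(3)] by (simp add: \<beta>)
  then have "c i dvd 2" by (metis dvd_triv_left)
  then have "c i \<le> 2" using zdvd_imp_le by simp
  moreover have "c i \<noteq> 0" using \<beta> root_neq_0[OF c(3)] by auto
  ultimately consider "c i = 1" | "c i = 1 + 1" using c(1)[of i] by linarith
  then show False
  proof cases
    case 1
    then show ?thesis using \<beta> ne by simp
  next
    case 2
    then have "\<beta> = ?\<alpha> + ?\<alpha>"
      using \<beta> by (simp only: zmod.scale_left_distrib zmod.scale_one)
    then show ?thesis using reduced[OF simple_root_in[OF i]] c(3) by simp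
  qed
qed

end

section \<open>Alternating words, the two sides of the braid relations\<close>

definition alternating_word :: "nat \<Rightarrow> 'a \<Rightarrow> 'a \<Rightarrow> 'a list" where
  "alternating_word k x y = map (\<lambda>l. if even l then x else y) [0..<k]"

lemma length_alternating_word [simp]: "length (alternating_word k x y) = k"
  by (simp add: alternating_word_def)

lemma alternating_word_0 [simp]: "alternating_word 0 x y = []"
  by (simp add: alternating_word_def)

lemma alternating_word_Suc: "alternating_word (Suc k) x y = x # alternating_word k y x"
proof -
  have "alternating_word (Suc k) x y =
      (if even (0 :: nat) then x else y) # map (\<lambda>l. if even l then x else y) (map Suc [0..<k])"
    unfolding alternating_word_def by (simp only: upt_conv_Cons[OF zero_less_Suc] list.map map_Suc_upt)
  then show ?thesis by (simp add: alternating_word_def)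
qed

lemma alternating_word_Suc_right:
  "alternating_word (Suc k) x y = alternating_word k x y @ [if even k then x else y]"
  by (simp add: alternating_word_def)

lemma set_alternating_word: "set (alternating_word k x y) \<subseteq> {x, y}"
  by (auto simp: alternating_word_def)

text \<open>Reversal inverts a word in involutions, so this product measures how far the two sides
  of a braid relation differ; it is the word of (xy)^k.\<close>

lemma alternating_word_append_rev:
  "alternating_word k x y @ rev (alternating_word k y x) = alternating_word (2 * k) x y"
proof (induction k arbitrary: x y)
  case (Suc k)
  have "alternating_word (Suc k) x y @ rev (alternating_word (Suc k) y x) =
      x # alternating_word (2 * k) y x @ [y]"
    using Suc[of y x] by (simp add: alternating_word_Suc)
  also have "\<dots> = alternating_word (Suc (2 * k)) x y @ [y]"
    by (simp add: alternating_word_Suc)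
  also have "\<dots> = alternating_word (2 * Suc k) x y"
    by (simp add: alternating_word_Suc_right)
  finally show ?case .
qed simp

text \<open>Positions two apart have equal parity. Deleting the letter \<open>a\<close> therefore
  brings two equal letters together, which cancel in the group.\<close>

lemma alternating_word_neighbours:
  assumes "alternating_word N x y = us @ a # vs" "us \<noteq> []" "vs \<noteq> []"
  shows "last us = hd vs"
proof -
  let ?p = "length us"
  have N: "?p + 1 < N" and "?p > 0"
    using arg_cong[OF assms(1), of length] assms(2,3) by (cases vs; simp)+
  have "last us = (us @ a # vs) ! (?p - 1)"
    using assms(2) by (simp add: last_conv_nth nth_append)
  moreover have "hd vs = (us @ a # vs) ! (?p + 1)"
    using assms(3) by (simp add: hd_conv_nth nth_append)
  moreover have "even (?p - 1) \<longleftrightarrow> even (?p + 1)"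
    using \<open>?p > 0\<close> by auto
  ultimately show ?thesis
    using N \<open>?p > 0\<close> unfolding assms(1)[symmetric]
    by (simp add: alternating_word_def del: even_Suc even_diff_nat)
qed

lemma alternating_prod_eq_word: "alternating_prod m (f x) (f y) = prod_list (map f (alternating_word m x y))"
  by (simp add: alternating_prod_def alternating_word_def comp_def if_distrib)

context based_root_datum
begin

section \<open>The exchange condition\<close>

lemma word_action_Nil [simp]: "word_action D [] = id"
  and word_action_Cons [simp]: "word_action D (i # xs) = simple_reflection D i \<circ> word_action D xs"
  by (simp_all add: word_action_def)

lemma word_action_append [simp]: "word_action D (xs @ ys) = word_action D xs \<circ> word_action D ys"
  by (induction xs) (simp_all add: comp_assoc)

abbreviation words :: "nat list set" where
  "words \<equiv> lists index_set"

lemma rev_in_words [simp]: "rev xs \<in> words \<longleftrightarrow> xs \<in> words"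
  by (simp add: in_lists_conv_set)

lemma simple_reflection_involution [simp]:
  "i \<in> index_set \<Longrightarrow> simple_reflection D i (simple_reflection D i x) = x"
  by (simp add: simple_reflection_def reflection_involution simple_root_in)

lemma simple_reflection_comp [simp]:
  "i \<in> index_set \<Longrightarrow> simple_reflection D i \<circ> simple_reflection D i = id"
  "i \<in> index_set \<Longrightarrow> simple_reflection D i \<circ> (simple_reflection D i \<circ> f) = f"
  by (auto simp: fun_eq_iff)

lemma word_action_rev:
  "xs \<in> words \<Longrightarrow> word_action D (rev xs) \<circ> word_action D xs = id"
  "xs \<in> words \<Longrightarrow> word_action D xs \<circ> word_action D (rev xs) = id"
proof -
  show *: "word_action D (rev xs) \<circ> word_action D xs = id" if "xs \<in> words" for xs
    using that by (induction xs) (auto simp: fun_eq_iff)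
  show "xs \<in> words \<Longrightarrow> word_action D xs \<circ> word_action D (rev xs) = id"
    using *[of "rev xs"] by simp
qed

lemma word_action_rev_apply [simp]:
  assumes "xs \<in> words"
  shows "word_action D (rev xs) (word_action D xs x) = x"
    and "word_action D xs (word_action D (rev xs) x) = x"
  using word_action_rev[OF assms] by (simp_all add: fun_eq_iff)

lemma additive_comp: "additive f \<Longrightarrow> additive g \<Longrightarrow> additive (f \<circ> g)"
  by (simp add: additive_def)

lemma simple_reflection_additive: "additive (simple_reflection D i)"
  by (simp add: simple_reflection_def[abs_def] reflection_additive)

lemma word_action_additive: "additive (word_action D xs)"
proof (induction xs)
  case Nil
  show ?case by (simp add: additive_def)
next
  case (Cons i xs)
  then show ?case
    using additive_comp[OF simple_reflection_additive] by (simp only: word_action_Cons)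
qed

lemma word_action_form:
  "xs \<in> words \<Longrightarrow> form (word_action D xs x) (word_action D xs y) = form x y"
  by (induction xs)
    (auto simp: simple_reflection_def form_reflection simple_root_in)

lemma word_action_roots:
  "xs \<in> words \<Longrightarrow> \<beta> \<in> roots D \<Longrightarrow> word_action D xs \<beta> \<in> roots D"
  using reflection_roots simple_root_in by (induction xs) (auto simp: simple_reflection_def)

text \<open>Equivariance of \<open>coroot\<close> is not an axiom of the root datum. It follows
  because \<open>form_root\<close> expresses the pairing by the invariant form, in which the
  positive factor \<open>form \<alpha> \<alpha>\<close> can be cancelled.\<close>

lemma pairing_coroot_word_action:
  assumes "xs \<in> words" "\<alpha> \<in> roots D"
  shows "pairing D (word_action D xs x) (coroot D (word_action D xs \<alpha>)) = pairing D x (coroot D \<alpha>)"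
proof -
  have "pairing D (word_action D xs x) (coroot D (word_action D xs \<alpha>)) * form \<alpha> \<alpha> =
      pairing D x (coroot D \<alpha>) * form \<alpha> \<alpha>"
    using form_root[OF word_action_roots[OF assms], of "word_action D xs x"] form_root[OF assms(2), of x]
    by (simp only: word_action_form[OF assms(1)])
  then show ?thesis
    using form_root_pos[OF assms(2)] by (metis mult_cancel_right less_irrefl)
qed

lemma reflection_word_action:
  assumes "xs \<in> words" "\<alpha> \<in> roots D"
  shows "reflection D (word_action D xs \<alpha>) (word_action D xs x) = word_action D xs (reflection D \<alpha> x)"
  by (simp add: reflection_def pairing_coroot_word_action[OF assms]
      additive.diff[OF word_action_additive] additive_zmul[OF word_action_additive])

text \<open>Reading the word from the right, the image of the simple root passes from positive to
  negative at some letter \<open>a\<close>. It must then be the simple root of \<open>a\<close>, so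
  by conjugation \<open>a\<close> in front of the remaining suffix equals \<open>i\<close> behind
  it, and \<open>a\<close> can be deleted.\<close>

lemma exchange_right:
  assumes "xs \<in> words" "i \<in> index_set" "word_action D xs (simple_root D i) \<notin> positive_roots D"
  shows "\<exists>ys a zs. xs = ys @ a # zs \<and> word_action D (xs @ [i]) = word_action D (ys @ zs)"
  using assms(1,3)
proof (induction xs)
  case Nil
  then show ?case using simple_root_positive[OF assms(2)] by simp
next
  case (Cons a xs)
  then have a: "a \<in> index_set" and xs: "xs \<in> words" by simp_all
  let ?\<beta> = "word_action D xs (simple_root D i)"
  show ?case
  proof (cases "?\<beta> \<in> positive_roots D")
    case True
    then have \<beta>: "?\<beta> = simple_root D a"
      using simple_reflection_positive[OF a] Cons.prems by auto
    have "simple_reflection D a (word_action D xs x) = word_action D xs (simple_reflection D i x)" for x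
      using reflection_word_action[OF xs simple_root_in[OF assms(2)], of x]
      by (simp add: \<beta> simple_reflection_def)
    then have "word_action D (xs @ [i]) = simple_reflection D a \<circ> word_action D xs"
      by (simp add: fun_eq_iff)
    then have "word_action D ((a # xs) @ [i]) = word_action D ([] @ xs)"
      using a by simp
    then show ?thesis
      by (intro exI[of _ "[]"]) blast
  next
    case False
    then obtain ys b zs where "xs = ys @ b # zs" "word_action D (xs @ [i]) = word_action D (ys @ zs)"
      using Cons.IH xs by blast
    then show ?thesis
      by (intro exI[of _ "a # ys"] exI[of _ b] exI[of _ zs]) simp
  qed
qed

section \<open>Length and reduced words\<close>

abbreviation len :: "('x \<Rightarrow> 'x) \<Rightarrow> nat" where
  "len \<equiv> weyl_length D"

lemma weyl_group_eq: "weyl_group D = word_action D ` words"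
  by (simp add: weyl_group_def index_set_def)

lemma len_le: "xs \<in> words \<Longrightarrow> len (word_action D xs) \<le> length xs"
  unfolding weyl_length_def index_set_def by (rule Least_le) blast

lemma reduced_word_iff:
  "reduced_word D w xs \<longleftrightarrow> xs \<in> words \<and> word_action D xs = w \<and> length xs = len w"
  by (simp add: reduced_word_def index_set_def)

lemma reduced_word_exists:
  assumes "w \<in> weyl_group D"
  obtains xs where "reduced_word D w xs"
proof -
  obtain xs where "xs \<in> words" "word_action D xs = w"
    using assms unfolding weyl_group_eq by blast
  then have "\<exists>k. \<exists>is\<in>lists {1..num_simple D}. word_action D is = w \<and> length is = k"
    unfolding index_set_def by blast
  from LeastI_ex[OF this] show ?thesis
    using that unfolding reduced_word_def weyl_length_def by metis
qed

lemma word_action_in_weyl_group: "xs \<in> words \<Longrightarrow> word_action D xs \<in> weyl_group D"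
  by (simp add: weyl_group_eq)

lemma weyl_group_comp_simple:
  assumes "w \<in> weyl_group D" "i \<in> index_set"
  shows "w \<circ> simple_reflection D i \<in> weyl_group D" "simple_reflection D i \<circ> w \<in> weyl_group D"
proof -
  obtain xs where xs: "xs \<in> words" "w = word_action D xs"
    using assms unfolding weyl_group_eq by blast
  have *: "xs @ [i] \<in> words" "i # xs \<in> words"
    using xs(1) assms(2) by simp_all
  show "w \<circ> simple_reflection D i \<in> weyl_group D" "simple_reflection D i \<circ> w \<in> weyl_group D"
    using *[THEN word_action_in_weyl_group] by (simp_all add: xs(2))
qed

lemma len_simple_right_less:
  assumes "w \<in> weyl_group D" "i \<in> index_set" "w (simple_root D i) \<notin> positive_roots D"
  shows "len (w \<circ> simple_reflection D i) < len w"
proof -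
  obtain xs where xs: "xs \<in> words" "word_action D xs = w" "length xs = len w"
    using reduced_word_exists[OF assms(1)] unfolding reduced_word_iff by blast
  obtain ys a zs where "xs = ys @ a # zs" "word_action D (xs @ [i]) = word_action D (ys @ zs)"
    using exchange_right[of xs i] xs assms by blast
  moreover from this have "ys @ zs \<in> words" using xs by auto
  moreover have "w \<circ> simple_reflection D i = word_action D (xs @ [i])"
    using xs(2) by simp
  ultimately have "len (w \<circ> simple_reflection D i) \<le> length (ys @ zs)" "length xs > length (ys @ zs)"
    using len_le[of "ys @ zs"] by (simp_all only: length_append list.size)
  then show ?thesis using xs(3) by simp
qed

text \<open>If \<open>w\<close> keeps the simple root positive, the product with the reflection
  makes it negative, so the strict drop for that product is an increase for \<open>w\<close>. The
  second claim keeps \<open>len w - 1\<close> from being a truncated subtraction.\<close>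

lemma len_simple_right:
  assumes "w \<in> weyl_group D" "i \<in> index_set"
  shows "len (w \<circ> simple_reflection D i) =
    (if w (simple_root D i) \<in> positive_roots D then len w + 1 else len w - 1)"
    "w (simple_root D i) \<notin> positive_roots D \<Longrightarrow> len w > 0"
proof -
  have upper: "len (v \<circ> simple_reflection D i) \<le> len v + 1" if "v \<in> weyl_group D" for v
  proof -
    obtain xs where xs: "xs \<in> words" "word_action D xs = v" "length xs = len v"
      using reduced_word_exists[OF \<open>v \<in> _\<close>] unfolding reduced_word_iff by blast
    then show ?thesis using len_le[of "xs @ [i]"] assms(2) by auto
  qed
  let ?ws = "w \<circ> simple_reflection D i"
  have ws: "?ws \<in> weyl_group D" "?ws \<circ> simple_reflection D i = w"
    using weyl_group_comp_simple assms by (auto simp: comp_assoc)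
  show "len w > 0" if "w (simple_root D i) \<notin> positive_roots D"
    using len_simple_right_less[OF assms that] by simp
  show "len ?ws = (if w (simple_root D i) \<in> positive_roots D then len w + 1 else len w - 1)"
  proof (cases "w (simple_root D i) \<in> positive_roots D")
    case True
    have "additive w"
      using assms(1) word_action_additive unfolding weyl_group_eq by auto
    then have "?ws (simple_root D i) = - w (simple_root D i)"
      using reflection_root[OF simple_root_in[OF assms(2)]]
      by (simp add: simple_reflection_def additive.minus)
    then have "?ws (simple_root D i) \<notin> positive_roots D"
      using uminus_positive_root[OF True] by simp
    then have "len w < len ?ws"
      using len_simple_right_less[OF ws(1) assms(2)] ws(2) by simp
    then show ?thesis using upper[OF assms(1)] True by simp
  next
    case False
    then show ?thesis
      using len_simple_right_less[OF assms False] upper[OF ws(1)] ws(2) by simp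
  qed
qed

text \<open>A reversed word represents the inverse; this transfers statements on right
  multiplication to left multiplication.\<close>

lemma len_rev:
  assumes "xs \<in> words"
  shows "len (word_action D (rev xs)) = len (word_action D xs)"
proof -
  have le: "len (word_action D (rev xs)) \<le> len (word_action D xs)" if xs: "xs \<in> words" for xs
  proof -
    have "word_action D xs \<in> weyl_group D" using xs by (simp add: weyl_group_eq)
    then obtain ys where ys: "ys \<in> words" "word_action D ys = word_action D xs"
      "length ys = len (word_action D xs)"
      using reduced_word_exists unfolding reduced_word_iff by metis
    have "word_action D (rev ys) x = word_action D (rev xs) x" for x
      using word_action_rev_apply(1)[OF ys(1), of "word_action D (rev xs) x"] xs by (simp add: ys(2))
    then have "word_action D (rev ys) = word_action D (rev xs)" by blast
    then show ?thesis
      using len_le[of "rev ys"] ys by simp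
  qed
  show ?thesis using le[of xs] le[of "rev xs"] assms by simp
qed

definition reduced :: "nat list \<Rightarrow> bool" where
  "reduced xs \<longleftrightarrow> xs \<in> words \<and> len (word_action D xs) = length xs"

lemma reduced_word_iff_reduced: "reduced_word D w xs \<longleftrightarrow> reduced xs \<and> word_action D xs = w"
  by (auto simp: reduced_word_iff reduced_def)

lemma not_reduced_if_shorter:
  assumes "us @ xs @ vs \<in> words" "ys \<in> words" "word_action D ys = word_action D xs" "length ys < length xs"
  shows "\<not> reduced (us @ xs @ vs)"
proof -
  have "word_action D (us @ xs @ vs) = word_action D (us @ ys @ vs)" by (simp add: assms)
  moreover have "us @ ys @ vs \<in> words" using assms by auto
  ultimately show ?thesis
    using len_le[of "us @ ys @ vs"] assms(4) by (simp add: reduced_def)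
qed

text \<open>The mirror image of \<open>exchange_right\<close> under reversal. The new word is as
  long as \<open>xs\<close> and represents the same element, hence is reduced too.\<close>

lemma exchange_left:
  assumes "reduced xs" "i \<in> index_set" "len (simple_reflection D i \<circ> word_action D xs) < length xs"
  obtains ys a zs where "xs = ys @ a # zs"
    "word_action D xs = word_action D (i # ys @ zs)" "reduced (i # ys @ zs)"
proof -
  have xs: "xs \<in> words" "len (word_action D xs) = length xs"
    using assms(1) by (simp_all add: reduced_def)
  have rev: "rev xs \<in> words" "word_action D (rev xs) \<in> weyl_group D"
    using xs by (auto simp: weyl_group_eq)
  have "len (word_action D (rev xs) \<circ> simple_reflection D i) =
      len (simple_reflection D i \<circ> word_action D xs)"
    using len_rev[of "i # xs"] xs assms(2) by simp
  then have "word_action D (rev xs) (simple_root D i) \<notin> positive_roots D"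
    using len_simple_right(1)[OF rev(2) assms(2)] len_rev[OF xs(1)] xs assms(3) by (auto split: if_splits)
  then obtain zs a ys where *: "rev xs = zs @ a # ys"
      "word_action D (rev xs @ [i]) = word_action D (zs @ ys)"
    using exchange_right[OF rev(1) assms(2)] by blast
  have xs_eq: "xs = rev ys @ a # rev zs"
    using arg_cong[OF *(1), of rev] by simp
  have W: "rev ys @ rev zs \<in> words" "zs @ ys \<in> words" using xs(1) xs_eq by auto
  \<comment> \<open>Both sides have the same inverse, namely the element to which the exchange was
    applied.\<close>
  have "word_action D (rev ys @ rev zs) = word_action D (i # xs)"
  proof -
    have "word_action D (rev (i # xs)) = word_action D (zs @ ys)"
      using *(2) by simp
    then have "word_action D (rev ys @ rev zs) (word_action D (rev (i # xs)) x) = x" for x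
      using word_action_rev_apply(1)[OF W(2), of x] by simp
    then have "word_action D (rev ys @ rev zs) x = word_action D (i # xs) x" for x
      using word_action_rev_apply(1)[of "i # xs" x] xs(1) assms(2) by (metis Cons_in_lists_iff)
    then show ?thesis by blast
  qed
  then have eq: "word_action D xs = word_action D (i # rev ys @ rev zs)"
    using assms(2) by simp
  moreover have "reduced (i # rev ys @ rev zs)"
    unfolding reduced_def eq[symmetric] using xs W assms(2) by (auto simp: xs_eq)
  ultimately show ?thesis using that xs_eq by blast
qed

section \<open>Finiteness of the Weyl group\<close>

lemma last_letter:
  assumes "w \<in> weyl_group D" "w \<noteq> id"
  obtains v i where "v \<in> weyl_group D" "i \<in> index_set" "w = v \<circ> simple_reflection D i"
    "len w = len v + 1" "v (simple_root D i) \<in> positive_roots D"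
proof -
  obtain xs where xs: "xs \<in> words" "word_action D xs = w" "length xs = len w"
    using reduced_word_exists[OF assms(1)] unfolding reduced_word_iff by blast
  then obtain ys i where ys: "xs = ys @ [i]"
    using assms(2) by (metis rev_exhaust word_action_Nil)
  then have *: "ys \<in> words" "i \<in> index_set" "w = word_action D ys \<circ> simple_reflection D i"
    using xs by auto
  then have W: "word_action D ys \<in> weyl_group D" by (simp add: weyl_group_eq)
  have "len (word_action D ys) \<le> length ys" using len_le *(1) by blast
  then have "len w > len (word_action D ys)" using xs ys by simp
  moreover have "len w = (if word_action D ys (simple_root D i) \<in> positive_roots D
      then len (word_action D ys) + 1 else len (word_action D ys) - 1)"
    using len_simple_right(1)[OF W *(2)] by (simp only: *(3))
  ultimately have "word_action D ys (simple_root D i) \<in> positive_roots D"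
    "len w = len (word_action D ys) + 1"
    by (auto split: if_splits)
  then show ?thesis using that[OF W *(2,3)] by simp
qed

lemma weyl_group_additive: "w \<in> weyl_group D \<Longrightarrow> additive w"
  using word_action_additive unfolding weyl_group_eq by auto

lemma weyl_group_form: "w \<in> weyl_group D \<Longrightarrow> form (w x) (w y) = form x y"
  using word_action_form unfolding weyl_group_eq by auto

lemma weyl_group_roots: "w \<in> weyl_group D \<Longrightarrow> \<beta> \<in> roots D \<Longrightarrow> w \<beta> \<in> roots D"
  using word_action_roots unfolding weyl_group_eq by auto

lemma id_in_weyl_group [simp]: "id \<in> weyl_group D"
  unfolding weyl_group_eq by (rule image_eqI[of _ _ "[]"]) simp_all

lemma weyl_group_comp: "v \<in> weyl_group D \<Longrightarrow> w \<in> weyl_group D \<Longrightarrow> v \<circ> w \<in> weyl_group D"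
proof -
  assume "v \<in> weyl_group D" "w \<in> weyl_group D"
  then obtain xs ys where "xs \<in> words" "ys \<in> words" "v = word_action D xs" "w = word_action D ys"
    unfolding weyl_group_eq by blast
  then show ?thesis
    using word_action_in_weyl_group[of "xs @ ys"] by simp
qed

lemma weyl_group_inverse:
  assumes "w \<in> weyl_group D"
  obtains v where "v \<in> weyl_group D" "v \<circ> w = id" "w \<circ> v = id"
proof -
  obtain xs where xs: "xs \<in> words" "w = word_action D xs"
    using assms unfolding weyl_group_eq by blast
  then have "word_action D (rev xs) \<in> weyl_group D"
    using word_action_in_weyl_group[of "rev xs"] by simp
  from that[OF this] show ?thesis
    using word_action_rev[OF xs(1)] unfolding xs(2) by simp
qed

text \<open>A nontrivial element makes the simple root of the last letter of a reduced word
  negative, so it cannot fix it.\<close>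

lemma weyl_group_id_if_fixes_roots:
  assumes "w \<in> weyl_group D" "\<And>\<beta>. \<beta> \<in> roots D \<Longrightarrow> w \<beta> = \<beta>"
  shows "w = id"
proof (rule ccontr)
  assume "w \<noteq> id"
  then obtain v i where v: "v \<in> weyl_group D" "i \<in> index_set" "w = v \<circ> simple_reflection D i"
    "v (simple_root D i) \<in> positive_roots D"
    using last_letter[OF assms(1) \<open>w \<noteq> id\<close>] by metis
  have "w (simple_root D i) = - v (simple_root D i)"
    using reflection_root[OF simple_root_in[OF v(2)]]
    by (simp add: v(3) simple_reflection_def additive.minus[OF weyl_group_additive[OF v(1)]])
  moreover have "w (simple_root D i) = simple_root D i"
    using assms(2) simple_root_in v(2) by blast
  ultimately show False
    using uminus_positive_root[OF v(4)] simple_root_positive[OF v(2)] by simp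
qed

text \<open>An element is determined by its permutation of the finitely many roots, although the
  roots need not span the weight lattice.\<close>

lemma finite_weyl_group: "finite (weyl_group D)"
proof (rule inj_on_finite)
  show "finite (roots D \<rightarrow>\<^sub>E roots D)"
    by (intro finite_PiE finite_roots)
  show "(\<lambda>w. restrict w (roots D)) ` weyl_group D \<subseteq> roots D \<rightarrow>\<^sub>E roots D"
    using weyl_group_roots by auto
  show "inj_on (\<lambda>w. restrict w (roots D)) (weyl_group D)"
  proof (rule inj_onI)
    fix v w
    assume v: "v \<in> weyl_group D" and w: "w \<in> weyl_group D"
      and eq: "restrict v (roots D) = restrict w (roots D)"
    obtain u where u: "u \<in> weyl_group D" "u \<circ> v = id" "v \<circ> u = id"
      using weyl_group_inverse[OF v] .
    have "v \<beta> = w \<beta>" if "\<beta> \<in> roots D" for \<beta>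
      using eq that by (metis restrict_apply')
    then have "(u \<circ> w) \<beta> = \<beta>" if "\<beta> \<in> roots D" for \<beta>
      using u(2) that by (metis comp_apply id_apply)
    then have uw: "u \<circ> w = id"
      using weyl_group_id_if_fixes_roots[OF weyl_group_comp[OF u(1) w]] by simp
    have "w = (v \<circ> u) \<circ> w"
      by (simp add: u(3))
    also have "\<dots> = v"
      by (simp only: comp_assoc uw comp_id)
    finally show "v = w" ..
  qed
qed

end

context based_root_datum
begin

section \<open>Matsumoto's theorem\<close>

lemma reduced_append_right:
  assumes "reduced (xs @ ys)"
  shows "reduced ys"
proof -
  have words: "xs \<in> words" "ys \<in> words"
    using assms by (simp_all add: reduced_def)
  obtain us where "us \<in> words" "word_action D us = word_action D ys" "length us = len (word_action D ys)"
    using reduced_word_exists[OF word_action_in_weyl_group[OF words(2)]] unfolding reduced_word_iff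
    by metis
  then have "len (word_action D ys) \<ge> length ys"
    using not_reduced_if_shorter[of xs ys "[]" us] assms words by fastforce
  then show ?thesis
    using len_le words by (simp add: reduced_def le_antisym)
qed

lemma funpow_in_weyl_group:
  assumes "w \<in> weyl_group D"
  shows "w ^^ k \<in> weyl_group D"
  by (induction k) (simp_all only: funpow.simps id_in_weyl_group weyl_group_comp[OF assms])

text \<open>In a finite group two powers of the product coincide, so the \<open>LEAST\<close> in the
  definition is attained.\<close>

lemma coxeter_order:
  assumes "i \<in> index_set" "j \<in> index_set"
  shows "coxeter_order D i j > 0"
    and "(simple_reflection D i \<circ> simple_reflection D j) ^^ coxeter_order D i j = id"
    and "0 < k \<Longrightarrow> k < coxeter_order D i j \<Longrightarrow> (simple_reflection D i \<circ> simple_reflection D j) ^^ k \<noteq> id"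
proof -
  let ?r = "simple_reflection D i \<circ> simple_reflection D j"
  have r: "?r \<in> weyl_group D"
    using word_action_in_weyl_group[of "[i, j]"] assms by simp
  have "\<not> inj (\<lambda>k :: nat. ?r ^^ k)"
  proof
    assume "inj (\<lambda>k :: nat. ?r ^^ k)"
    moreover have "finite (range (\<lambda>k. ?r ^^ k))"
      by (rule finite_subset[OF _ finite_weyl_group]) (use funpow_in_weyl_group[OF r] in blast)
    ultimately show False
      using finite_imageD by blast
  qed
  then obtain a b :: nat where ab: "a < b" "?r ^^ a = ?r ^^ b"
    unfolding inj_def by (metis linorder_neqE_nat)
  obtain u where u: "u \<circ> ?r ^^ a = id"
    using weyl_group_inverse[OF funpow_in_weyl_group[OF r]] by metis
  have "?r ^^ b = ?r ^^ a \<circ> ?r ^^ (b - a)"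
    using ab(1) by (simp flip: funpow_add)
  then have "u \<circ> ?r ^^ a = (u \<circ> ?r ^^ a) \<circ> ?r ^^ (b - a)"
    using ab(2) by (simp only: comp_assoc)
  then have "\<exists>m>0. ?r ^^ m = id"
    using ab(1) by (intro exI[of _ "b - a"]) (simp add: u)
  from LeastI_ex[OF this] show "coxeter_order D i j > 0" "?r ^^ coxeter_order D i j = id"
    unfolding coxeter_order_def by blast+
  show "0 < k \<Longrightarrow> k < coxeter_order D i j \<Longrightarrow> ?r ^^ k \<noteq> id"
    unfolding coxeter_order_def using not_less_Least by blast
qed

lemma alternating_word_in_words:
  "x \<in> index_set \<Longrightarrow> y \<in> index_set \<Longrightarrow> alternating_word k x y \<in> words"
  using set_alternating_word[of k x y] by auto

lemma word_action_alternating_double: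
  "word_action D (alternating_word (2 * k) x y) = (simple_reflection D x \<circ> simple_reflection D y) ^^ k"
  by (induction k) (simp_all add: alternating_word_Suc comp_assoc)

lemma word_action_alternating_eq_iff:
  assumes "x \<in> index_set" "y \<in> index_set"
  shows "word_action D (alternating_word k x y) = word_action D (alternating_word k y x) \<longleftrightarrow>
    (simple_reflection D x \<circ> simple_reflection D y) ^^ k = id"
proof -
  let ?f = "word_action D (alternating_word k x y)" and ?g = "word_action D (alternating_word k y x)"
    and ?h = "word_action D (rev (alternating_word k y x))"
  have g: "?h \<circ> ?g = id" "?g \<circ> ?h = id"
    using word_action_rev alternating_word_in_words assms by blast+
  have "(simple_reflection D x \<circ> simple_reflection D y) ^^ k = ?f \<circ> ?h"
    by (simp only: alternating_word_append_rev flip: word_action_append word_action_alternating_double)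
  moreover have "?f = ?g" if "?f \<circ> ?h = id"
    using that g(1) by (metis comp_assoc comp_id id_comp)
  ultimately show ?thesis using g(2) by metis
qed

text \<open>The alternating prefix grows by exchange with the descent it does not start with: deleting a
  letter inside the prefix would either make two equal neighbours cancel or yield a relation
  \<open>(s\<^sub>x s\<^sub>y)\<^sup>k = 1\<close> with \<open>k\<close> below the order.\<close>

lemma alternating_reduced_word:
  assumes w: "w \<in> weyl_group D" and ij: "i \<in> index_set" "j \<in> index_set"
    and desc: "len (simple_reflection D i \<circ> w) < len w" "len (simple_reflection D j \<circ> w) < len w"
    and k: "1 \<le> k" "k \<le> coxeter_order D i j"
  shows "\<exists>x y c. (x = i \<and> y = j \<or> x = j \<and> y = i) \<and> reduced (alternating_word k x y @ c)
    \<and> word_action D (alternating_word k x y @ c) = w"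
  using k
proof (induction k rule: nat_induct_at_least)
  case base
  obtain xs where xs: "reduced xs" "word_action D xs = w"
    using reduced_word_exists[OF w] unfolding reduced_word_iff_reduced by blast
  then obtain ys a zs where *: "word_action D xs = word_action D (i # ys @ zs)" "reduced (i # ys @ zs)"
    using exchange_left[OF xs(1) ij(1)] desc(1) by (metis reduced_def)
  then show ?case
    using xs(2) by (intro exI[of _ i] exI[of _ j] exI[of _ "ys @ zs"])
      (simp add: alternating_word_Suc)
next
  case (Suc k)
  then obtain x y c where xy: "x = i \<and> y = j \<or> x = j \<and> y = i"
    and red: "reduced (alternating_word k x y @ c)"
    and act: "word_action D (alternating_word k x y @ c) = w" using Suc.IH Suc_leD by blast
  have xy_in: "x \<in> index_set" "y \<in> index_set" using xy ij by auto
  have not_id: "word_action D (alternating_word k x y) \<noteq> word_action D (alternating_word k y x)"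
    using xy coxeter_order(3)[OF ij, of k] Suc.hyps Suc.prems
      word_action_alternating_eq_iff[OF ij, of k] by auto
  have lenw: "length (alternating_word k x y @ c) = len w"
    using red act unfolding reduced_def by simp
  have "len (simple_reflection D y \<circ> w) < len w" using xy desc by auto
  then obtain ys a zs where ex: "alternating_word k x y @ c = ys @ a # zs"
      "w = word_action D (y # ys @ zs)" "reduced (y # ys @ zs)"
    using exchange_left[OF red xy_in(2)] act lenw by metis
  show ?case
  proof (cases "length ys < k")
    \<comment> \<open>The deleted letter lies behind the alternating prefix, which is intact and is
      prolonged by \<open>y\<close> in front.\<close>
    case False
    define ys' where "ys' = drop k ys"
    have "ys = take k (alternating_word k x y @ c) @ ys'"
      using False ex(1) by (simp add: ys'_def)
    then have "y # ys @ zs = alternating_word (Suc k) y x @ (ys' @ zs)"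
      by (simp add: alternating_word_Suc)
    then show ?thesis
      using ex xy by metis
  next
    case True
    define zs' where "zs' = take (k - Suc (length ys)) zs"
    have "alternating_word k x y = take k (ys @ a # zs)"
      unfolding ex(1)[symmetric] by simp
    also have "\<dots> = ys @ a # zs'"
      using True by (auto simp: zs'_def take_Cons' less_imp_diff_less)
    finally have alt: "alternating_word k x y = ys @ a # zs'" .
    then have zs: "zs = zs' @ c" using ex(1) by simp
    have "word_action D (alternating_word k x y @ c) = word_action D (y # ys @ zs' @ c)"
      using act ex(2) zs by simp
    moreover have "c \<in> words" using red by (simp add: reduced_def)
    ultimately have eq: "word_action D (alternating_word k x y) = word_action D (y # ys @ zs')"
    proof -
      assume *: "word_action D (alternating_word k x y @ c) = word_action D (y # ys @ zs' @ c)"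
        and c: "c \<in> words"
      have "word_action D (alternating_word k x y) z = word_action D (y # ys @ zs') z" for z
        using fun_cong[OF *, of "word_action D (rev c) z"] c by simp
      then show ?thesis by blast
    qed
    have False
    proof (cases "zs' = []")
      \<comment> \<open>The last letter of the prefix was deleted: what remains, with
        \<open>y\<close> in front, is the opposite alternating word of the same length
        \<open>k\<close>, which is below the order.\<close>
      case True
      then have "alternating_word (Suc (length ys)) x y = ys @ [a]"
        using alt arg_cong[OF alt, of length]
        by (metis True length_alternating_word length_append_singleton)
      then have "ys = alternating_word (length ys) x y"
        unfolding alternating_word_Suc_right by simp
      then have "y # ys = alternating_word k y x"
        using arg_cong[OF alt, of length] True by (metis alternating_word_Suc
            length_alternating_word length_append_singleton)
      then show False
        using eq True not_id by simp
    next
      case False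
      \<comment> \<open>A letter inside was deleted; its equal neighbours cancel, and the prefix
        would have a word shorter by two.\<close>
      have yalt: "alternating_word (Suc k) y x = (y # ys) @ a # zs'"
        by (simp add: alternating_word_Suc alt)
      have last: "last (y # ys) = hd zs'"
        using alternating_word_neighbours[OF yalt _ False] by simp
      obtain us where us: "y # ys = us @ [hd zs']"
        by (metis last append_butlast_last_id list.distinct(1))
      obtain vs where vs: "zs' = hd zs' # vs"
        using False by (metis list.collapse)
      have words: "alternating_word k x y \<in> words"
        using alternating_word_in_words xy_in by blast
      then have "zs' \<in> words" "ys \<in> words" using alt by auto
      then have "hd zs' \<in> index_set" "vs \<in> words" "us \<in> words"
        using us vs xy_in by (metis Cons_in_lists_iff append_in_lists_conv)+
      have "y # ys @ zs' = us @ [hd zs'] @ [hd zs'] @ vs"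
        using us vs by (metis append.assoc append_Cons append_Nil)
      then have "word_action D (alternating_word k x y) = word_action D (us @ vs)"
        using eq \<open>hd zs' \<in> index_set\<close> by simp
      moreover have "length (us @ vs) < length (alternating_word k x y)"
        using arg_cong[OF us, of length] arg_cong[OF vs, of length] unfolding alt by simp
      ultimately show False
        using not_reduced_if_shorter[of "[]" "alternating_word k x y" c "us @ vs"] red words
          \<open>vs \<in> words\<close> \<open>us \<in> words\<close> \<open>c \<in> words\<close> by simp
    qed
    then show ?thesis ..
  qed
qed

text \<open>Two reduced words with different first letters \<open>i\<close> and \<open>j\<close> are
  joined through a third element of the chain: since both letters are left descents, there are
  reduced words beginning with either side of the braid relation of \<open>i\<close> and
  \<open>j\<close>. One braid move links these two, and equal first letters do the rest.\<close>

theorem matsumoto: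
  fixes f :: "nat \<Rightarrow> 'm::monoid_mult"
  assumes braid: "\<And>i j. \<lbrakk>i \<in> index_set; j \<in> index_set; i \<noteq> j\<rbrakk> \<Longrightarrow>
      prod_list (map f (alternating_word (coxeter_order D i j) i j)) =
      prod_list (map f (alternating_word (coxeter_order D i j) j i))"
    and "reduced xs" "reduced ys" "word_action D xs = word_action D ys"
  shows "prod_list (map f xs) = prod_list (map f ys)"
  using assms(2-)
proof (induction "length xs" arbitrary: xs ys)
  case 0
  then have "len (word_action D ys) = 0" "xs = []"
    unfolding reduced_def by (metis, simp)
  then show ?case
    using 0(3) by (simp add: reduced_def)
next
  case (Suc n)
  let ?F = "\<lambda>xs. prod_list (map f xs)"
  \<comment> \<open>The common first letter is cancelled; the tails are reduced words of one element
    and shorter, so the induction hypothesis applies.\<close>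
  have same_head: "?F (i # as) = ?F (i # bs)"
    if "length (i # as) = Suc n" "reduced (i # as)" "reduced (i # bs)"
      "word_action D (i # as) = word_action D (i # bs)" for i as bs
  proof -
    have i: "i \<in> index_set" using that(2) by (simp add: reduced_def)
    have "word_action D as = simple_reflection D i \<circ> word_action D (i # as)"
      using i by simp
    also have "\<dots> = word_action D bs"
      unfolding that(4) using i by simp
    finally have "word_action D as = word_action D bs" .
    then show ?thesis
      using Suc.hyps(1)[of as bs] that reduced_append_right[of "[i]"] by simp
  qed
  let ?w = "word_action D xs"
  have "length ys = Suc n"
    using Suc by (simp add: reduced_def)
  then obtain i as j bs where xs: "xs = i # as" and ys: "ys = j # bs"
    using Suc.hyps(2) by (metis length_Suc_conv)
  have i: "i \<in> index_set" "as \<in> words" and j: "j \<in> index_set" "bs \<in> words"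
    using Suc.prems by (simp_all add: xs ys reduced_def)
  have w: "?w \<in> weyl_group D" "len ?w = Suc n"
    using Suc.prems Suc.hyps(2) word_action_in_weyl_group by (simp_all add: reduced_def)
  have desc: "len (simple_reflection D i \<circ> ?w) < len ?w" "len (simple_reflection D j \<circ> ?w) < len ?w"
  proof -
    have "simple_reflection D i \<circ> ?w = word_action D as"
      using i by (simp add: xs)
    moreover have "simple_reflection D j \<circ> ?w = word_action D bs"
      unfolding Suc.prems(3) using j by (simp add: ys)
    moreover have "length as < len ?w" "length bs < len ?w"
      using w(2) Suc.hyps(2) \<open>length ys = Suc n\<close> by (simp_all add: xs ys)
    ultimately show "len (simple_reflection D i \<circ> ?w) < len ?w" "len (simple_reflection D j \<circ> ?w) < len ?w"
      using len_le[OF i(2)] len_le[OF j(2)] by simp_all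
  qed
  show ?case
  proof (cases "i = j")
    case True
    then show ?thesis
      using same_head[of i as bs] Suc.prems Suc.hyps(2) by (simp add: xs ys)
  next
    case False
    let ?m = "coxeter_order D i j"
    obtain m' where m': "?m = Suc m'"
      using coxeter_order(1)[OF i(1) j(1)] gr0_conv_Suc by blast
    \<comment> \<open>It is left open which side of the braid relation occurs; replacing it by the
      other side preserves the element and the length, so both words are reduced.\<close>
    obtain x y c where xy: "x = i \<and> y = j \<or> x = j \<and> y = i"
      and red: "reduced (alternating_word ?m x y @ c)"
      and act: "word_action D (alternating_word ?m x y @ c) = ?w"
      using alternating_reduced_word[OF w(1) i(1) j(1) desc, of ?m] m' by auto
    have xy_in: "x \<in> index_set" "y \<in> index_set" using xy i j by auto
    have "(simple_reflection D x \<circ> simple_reflection D y) ^^ ?m = id"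
      using xy coxeter_order(2)[OF i(1) j(1)] word_action_alternating_eq_iff[OF i(1) j(1), of ?m]
        word_action_alternating_eq_iff[OF j(1) i(1), of ?m] by metis
    then have "word_action D (alternating_word ?m x y) = word_action D (alternating_word ?m y x)"
      using word_action_alternating_eq_iff[OF xy_in] by blast
    then have act': "word_action D (alternating_word ?m y x @ c) = ?w"
      using act by simp
    have red': "reduced (alternating_word ?m y x @ c)"
      using red act act' alternating_word_in_words[OF xy_in(2,1)] unfolding reduced_def by simp
    have "?F (alternating_word ?m x y @ c) = ?F (alternating_word ?m y x @ c)"
      using braid[OF i(1) j(1) False] xy by auto
    moreover have "reduced (alternating_word ?m i j @ c)" "reduced (alternating_word ?m j i @ c)"
      "word_action D (alternating_word ?m i j @ c) = ?w" "word_action D (alternating_word ?m j i @ c) = ?w"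
      using red red' act act' xy by metis+
    ultimately have *: "?F (alternating_word ?m i j @ c) = ?F (alternating_word ?m j i @ c)"
      "reduced (i # alternating_word m' j i @ c)" "reduced (j # alternating_word m' i j @ c)"
      "word_action D (i # alternating_word m' j i @ c) = ?w"
      "word_action D (j # alternating_word m' i j @ c) = ?w"
      using xy by (auto simp: m' alternating_word_Suc)
    have "?F xs = ?F (i # alternating_word m' j i @ c)"
      unfolding xs
      by (rule same_head) (use *(2,4) Suc.prems Suc.hyps(2) in \<open>simp_all only: xs\<close>)
    also have "\<dots> = ?F (j # alternating_word m' i j @ c)"
      using *(1) by (simp add: m' alternating_word_Suc)
    also have "\<dots> = ?F ys"
      unfolding ys
      by (rule same_head[symmetric])
        (use *(3,5) Suc.prems \<open>length ys = Suc n\<close> in \<open>simp_all only: ys\<close>)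
    finally show ?thesis .
  qed
qed

end

section \<open>Determinants of lattice endomorphisms\<close>

text \<open>The matrix determinant lemma. One block matrix with identity diagonal blocks is cleared
  in two ways by unitriangular factors, leaving the Schur complements 1 - UV and 1 - VU; no division
  occurs.\<close>

lemma det_one_minus_rank_one:
  fixes u v :: "nat \<Rightarrow> 'a::idom"
  shows "det (mat n n (\<lambda>(i, j). (if i = j then 1 else 0) - u i * v j)) = 1 - (\<Sum>i<n. v i * u i)"
proof -
  define U where "U = mat n 1 (\<lambda>(i, _). u i)"
  define V where "V = mat 1 n (\<lambda>(_, j). v j)"
  have U: "U \<in> carrier_mat n 1" and V: "V \<in> carrier_mat 1 n" by (simp_all add: U_def V_def)
  let ?M = "four_block_mat (1\<^sub>m 1) V U (1\<^sub>m n)"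
  let ?L = "four_block_mat (1\<^sub>m 1) (0\<^sub>m 1 n) (- U) (1\<^sub>m n)"
  let ?R = "four_block_mat (1\<^sub>m 1) (- V) (0\<^sub>m n 1) (1\<^sub>m n)"
  have carrier: "?M \<in> carrier_mat (1 + n) (1 + n)" "?L \<in> carrier_mat (1 + n) (1 + n)"
    "?R \<in> carrier_mat (1 + n) (1 + n)"
    using U V by auto
  have mult_R: "?M * ?R = four_block_mat (1\<^sub>m 1) (0\<^sub>m 1 n) U (1\<^sub>m n - U * V)"
  proof -
    have "1\<^sub>m 1 * 1\<^sub>m 1 + V * 0\<^sub>m n 1 = 1\<^sub>m 1" "1\<^sub>m 1 * - V + V * 1\<^sub>m n = 0\<^sub>m 1 n"
      "U * 1\<^sub>m 1 + 1\<^sub>m n * 0\<^sub>m n 1 = U" "U * - V + 1\<^sub>m n * 1\<^sub>m n = 1\<^sub>m n - U * V"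
      using U V by (auto intro!: eq_matI simp del: One_nat_def)
    then show ?thesis
      using mult_four_block_mat[of "1\<^sub>m 1" 1 1 V n U n "1\<^sub>m n" "1\<^sub>m 1" 1 "- V" n "0\<^sub>m n 1" "1\<^sub>m n"] U V
      by simp
  qed
  have mult_L: "?M * ?L = four_block_mat (1\<^sub>m 1 - V * U) V (0\<^sub>m n 1) (1\<^sub>m n)"
  proof -
    have "1\<^sub>m 1 * 1\<^sub>m 1 + V * - U = 1\<^sub>m 1 - V * U" "1\<^sub>m 1 * 0\<^sub>m 1 n + V * 1\<^sub>m n = V"
      "U * 1\<^sub>m 1 + 1\<^sub>m n * - U = 0\<^sub>m n 1" "U * 0\<^sub>m 1 n + 1\<^sub>m n * 1\<^sub>m n = 1\<^sub>m n"
      using U V by (auto intro!: eq_matI simp del: One_nat_def)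
    then show ?thesis
      using mult_four_block_mat[of "1\<^sub>m 1" 1 1 V n U n "1\<^sub>m n" "1\<^sub>m 1" 1 "0\<^sub>m 1 n" n "- U" "1\<^sub>m n"] U V
      by simp
  qed
  have detR: "det ?R = 1"
    by (subst det_four_block_mat_lower_left_zero[of _ 1 _ n]) (use U V in auto)
  have detL: "det ?L = 1"
    by (subst det_four_block_mat_upper_right_zero[of _ 1 _ n]) (use U V in auto)
  have "det ?M = det (?M * ?R)"
    by (simp only: det_mult[OF carrier(1,3)] detR mult_1_right)
  also have "\<dots> = det (1\<^sub>m n - U * V)"
    unfolding mult_R by (subst det_four_block_mat_upper_right_zero[of _ 1 _ n]) (use U V in auto)
  finally have *: "det ?M = det (1\<^sub>m n - U * V)" .
  have "det ?M = det (?M * ?L)"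
    by (simp only: det_mult[OF carrier(1,2)] detL mult_1_right)
  also have "\<dots> = det (1\<^sub>m 1 - V * U)"
    unfolding mult_L by (subst det_four_block_mat_lower_left_zero[of _ 1 _ n]) (use U V in auto)
  also have "\<dots> = 1 - (\<Sum>i<n. v i * u i)"
    by (subst det_single) (auto simp: U_def V_def scalar_prod_def atLeast0LessThan)
  finally have "det (1\<^sub>m n - U * V) = 1 - (\<Sum>i<n. v i * u i)"
    using * by simp
  moreover have "1\<^sub>m n - U * V = mat n n (\<lambda>(i, j). (if i = j then 1 else 0) - u i * v j)"
    by (rule eq_matI) (auto simp: U_def V_def scalar_prod_def)
  ultimately show ?thesis by simp
qed

lemma lattice_basis_representation:
  assumes "lattice_basis bs"
  shows "(\<Sum>i<length bs. zmul (zmod.representation (set bs) x (bs ! i)) (bs ! i)) = x"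
proof -
  have "(\<Sum>b\<in>set bs. zmul (zmod.representation (set bs) x b) b) = x"
    by (rule zmod.sum_representation_eq) (use assms in \<open>simp_all add: lattice_basis_def\<close>)
  moreover have "bij_betw ((!) bs) {..<length bs} (set bs)"
    using assms bij_betw_nth by (fastforce simp: lattice_basis_def)
  ultimately show ?thesis
    using sum.reindex_bij_betw[of "(!) bs" "{..<length bs}" "set bs"
        "\<lambda>b. zmul (zmod.representation (set bs) x b) b"] by simp
qed

lemma lattice_representation_additive:
  assumes "lattice_basis bs"
  shows "additive (\<lambda>x. zmod.representation (set bs) x b)"
  using assms by (auto simp: additive_def lattice_basis_def zmod.representation_add)

lemma lattice_representation_basis:
  assumes "lattice_basis bs" "i < length bs" "j < length bs"
  shows "zmod.representation (set bs) (bs ! j) (bs ! i) = (if i = j then 1 else 0)"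
  using assms by (simp add: lattice_basis_def zmod.representation_basis nth_eq_iff_index_eq)

lemma lattice_det_comp:
  fixes f g :: "'a::ab_group_add \<Rightarrow> 'a"
  assumes "\<exists>bs :: 'a list. lattice_basis bs" "additive f" "additive g"
  shows "lattice_det (f \<circ> g) = lattice_det f * lattice_det g"
proof -
  define bs :: "'a list" where "bs = (SOME bs. lattice_basis bs)"
  let ?rep = "zmod.representation (set bs)" and ?r = "length bs"
  have bs: "lattice_basis bs"
    unfolding bs_def using assms(1) by (rule someI_ex)
  define M where "M h = mat ?r ?r (\<lambda>(i, j). ?rep (h (bs ! j)) (bs ! i))" for h :: "'a \<Rightarrow> 'a"
  have det: "lattice_det h = det (M h)" for h
    by (simp add: lattice_det_def M_def bs_def Let_def)
  have "M (f \<circ> g) = M f * M g"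
  proof (rule eq_matI)
    fix i j assume "i < dim_row (M f * M g)" "j < dim_col (M f * M g)"
    then have ij: "i < ?r" "j < ?r" by (simp_all add: M_def)
    note rep = lattice_representation_additive[OF bs]
    have "f (g (bs ! j)) = (\<Sum>k<?r. zmul (?rep (g (bs ! j)) (bs ! k)) (f (bs ! k)))"
      by (subst (1) lattice_basis_representation[OF bs, of "g (bs ! j)", symmetric])
        (simp add: additive.sum[OF assms(2)] additive_zmul[OF assms(2)])
    then have "?rep (f (g (bs ! j))) (bs ! i) =
        (\<Sum>k<?r. ?rep (f (bs ! k)) (bs ! i) * ?rep (g (bs ! j)) (bs ! k))"
      by (simp add: additive.sum[OF rep] additive_zmul[OF rep] mult.commute)
    then show "M (f \<circ> g) $$ (i, j) = (M f * M g) $$ (i, j)"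
      using ij by (simp add: M_def scalar_prod_def atLeast0LessThan)
  qed (simp_all add: M_def)
  moreover have "M f \<in> carrier_mat ?r ?r" "M g \<in> carrier_mat ?r ?r"
    by (simp_all add: M_def)
  ultimately show ?thesis
    unfolding det by (simp add: det_mult)
qed

text \<open>In a lattice basis this map is the identity minus a matrix of rank one. The value
  \<open>h a = 2\<close> gives a reflection, of determinant -1, and \<open>h = 0\<close> gives the
  identity.\<close>

lemma lattice_det_transvection:
  fixes a :: "'a::ab_group_add"
  assumes "\<exists>bs :: 'a list. lattice_basis bs" "additive h"
  shows "lattice_det (\<lambda>x. x - zmul (h x) a) = 1 - h a"
proof -
  define bs :: "'a list" where "bs = (SOME bs. lattice_basis bs)"
  let ?rep = "zmod.representation (set bs)" and ?r = "length bs"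
  have bs: "lattice_basis bs"
    unfolding bs_def using assms(1) by (rule someI_ex)
  note rep = lattice_representation_additive[OF bs]
  have "lattice_det (\<lambda>x. x - zmul (h x) a) =
      det (mat ?r ?r (\<lambda>(i, j). ?rep (bs ! j - zmul (h (bs ! j)) a) (bs ! i)))"
    by (simp add: lattice_det_def bs_def Let_def)
  also have "mat ?r ?r (\<lambda>(i, j). ?rep (bs ! j - zmul (h (bs ! j)) a) (bs ! i)) =
      mat ?r ?r (\<lambda>(i, j). (if i = j then 1 else 0) - ?rep a (bs ! i) * h (bs ! j))"
    by (rule eq_matI)
      (auto simp: additive.diff[OF rep] additive_zmul[OF rep] lattice_representation_basis[OF bs] mult.commute)
  also have "det \<dots> = 1 - (\<Sum>i<?r. h (bs ! i) * ?rep a (bs ! i))"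
    by (rule det_one_minus_rank_one)
  also have "(\<Sum>i<?r. h (bs ! i) * ?rep a (bs ! i)) = h a"
    by (subst (2) lattice_basis_representation[OF bs, of a, symmetric])
      (simp add: additive.sum[OF assms(2)] additive_zmul[OF assms(2)] mult.commute)
  finally show ?thesis .
qed

section \<open>The sign character of the Weyl group\<close>

context based_root_datum
begin

lemma lattice_det_simple:
  assumes "w \<in> weyl_group D" "i \<in> index_set"
  shows "lattice_det (w \<circ> simple_reflection D i) = - lattice_det w"
proof -
  have "lattice_det (simple_reflection D i) = -1"
    using lattice_det_transvection[OF lattice pairing_additive_left, of "coroot D (simple_root D i)" "simple_root D i"]
    by (simp add: simple_reflection_def[abs_def] reflection_def[abs_def] pairing_root_coroot
        simple_root_in[OF assms(2)])
  then show ?thesis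
    using lattice_det_comp[OF lattice weyl_group_additive[OF assms(1)] simple_reflection_additive]
    by simp
qed

lemma lattice_det_id: "lattice_det (id :: 'x \<Rightarrow> 'x) = 1"
  using lattice_det_transvection[OF lattice, of "\<lambda>_. 0" 0] by (simp add: additive_def id_def)

lemma lattice_det_square:
  assumes "w \<in> weyl_group D"
  shows "lattice_det w * lattice_det w = 1"
proof -
  have "lattice_det (word_action D xs) * lattice_det (word_action D xs) = 1" if "xs \<in> words" for xs
    using that
  proof (induction xs rule: rev_induct)
    case (snoc i xs)
    then have "xs \<in> words" "i \<in> index_set" by simp_all
    moreover from this have "lattice_det (word_action D (xs @ [i])) = - lattice_det (word_action D xs)"
      using lattice_det_simple[OF word_action_in_weyl_group]
      by (simp only: word_action_append word_action_Cons word_action_Nil comp_id)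
    ultimately show ?case
      using snoc by (simp del: word_action_append)
  qed (simp add: lattice_det_id)
  then show ?thesis
    using assms unfolding weyl_group_eq by blast
qed

end

section \<open>Group algebras\<close>

lemma group_alg_expansion:
  fixes f :: "'x \<Rightarrow>\<^sub>0 'r::comm_monoid_add"
  shows "f = (\<Sum>\<mu>\<in>Poly_Mapping.keys f. Poly_Mapping.single \<mu> (Poly_Mapping.lookup f \<mu>))"
  by (rule poly_mapping_eqI)
    (auto simp: lookup_sum lookup_single when_def in_keys_iff sum.delta)

lemma lookup_single_times:
  fixes g :: "'x::ab_group_add \<Rightarrow>\<^sub>0 'r::comm_ring_1"
  shows "Poly_Mapping.lookup (Poly_Mapping.single \<mu> c * g) \<nu> = c * Poly_Mapping.lookup g (\<nu> - \<mu>)"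
proof -
  have "Poly_Mapping.single \<mu> c * g =
      (\<Sum>\<kappa>\<in>Poly_Mapping.keys g. Poly_Mapping.single (\<mu> + \<kappa>) (c * Poly_Mapping.lookup g \<kappa>))"
    by (subst (1) group_alg_expansion[of g]) (simp add: sum_distrib_left mult_single)
  then have "Poly_Mapping.lookup (Poly_Mapping.single \<mu> c * g) \<nu> =
      (\<Sum>\<kappa>\<in>Poly_Mapping.keys g. if \<kappa> = \<nu> - \<mu> then c * Poly_Mapping.lookup g \<kappa> else 0)"
    by (auto simp: lookup_sum lookup_single when_def algebra_simps intro!: sum.cong)
  then show ?thesis
    by (simp add: in_keys_iff)
qed

lemma lookup_times:
  fixes f g :: "'x::ab_group_add \<Rightarrow>\<^sub>0 'r::comm_ring_1"
  shows "Poly_Mapping.lookup (f * g) \<nu> =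
    (\<Sum>\<mu>\<in>Poly_Mapping.keys f. Poly_Mapping.lookup f \<mu> * Poly_Mapping.lookup g (\<nu> - \<mu>))"
  by (subst (1) group_alg_expansion[of f]) (simp add: sum_distrib_right lookup_sum lookup_single_times)

text \<open>Take any exponent \<mu> of \<open>q\<close> of maximal height. Only the product of its
  term with the leading term of \<open>f\<close> reaches exponent \<mu> + \<kappa>, so that
  coefficient survives. Uniqueness of the maximum is required of \<open>f\<close> alone, hence no
  total order on the exponents.\<close>

lemma leading_term_regular:
  fixes f q :: "'x::ab_group_add \<Rightarrow>\<^sub>0 'r::idom" and h :: "'x \<Rightarrow> int"
  assumes "additive h" and "Poly_Mapping.lookup f \<kappa> \<noteq> 0"
    and "\<And>\<mu>. \<mu> \<in> Poly_Mapping.keys f \<Longrightarrow> \<mu> \<noteq> \<kappa> \<Longrightarrow> h \<mu> < h \<kappa>"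
    and "q * f = 0"
  shows "q = 0"
proof (rule ccontr)
  let ?K = "Poly_Mapping.keys q"
  assume "q \<noteq> 0"
  then have "?K \<noteq> {}" by simp
  then have "Max (h ` ?K) \<in> h ` ?K" by (intro Max_in) simp_all
  then obtain \<mu> where \<mu>: "\<mu> \<in> ?K" "h \<mu> = Max (h ` ?K)" by (metis imageE)
  have max: "h \<nu> \<le> h \<mu>" if "\<nu> \<in> ?K" for \<nu>
    using that by (simp add: \<mu>(2))
  have zero: "Poly_Mapping.lookup q \<nu> * Poly_Mapping.lookup f (\<mu> + \<kappa> - \<nu>) = 0"
    if "\<nu> \<in> ?K - {\<mu>}" for \<nu>
  proof (rule ccontr)
    assume "\<not> ?thesis"
    then have "\<mu> + \<kappa> - \<nu> \<in> Poly_Mapping.keys f" by (simp add: in_keys_iff)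
    moreover have "\<mu> + \<kappa> - \<nu> \<noteq> \<kappa>" using that by auto
    ultimately have "h (\<mu> + \<kappa> - \<nu>) < h \<kappa>" by (rule assms(3))
    then show False
      using max[of \<nu>] that by (simp add: additive.diff[OF assms(1)] additive.add[OF assms(1)])
  qed
  have "(\<Sum>\<nu>\<in>?K - {\<mu>}. Poly_Mapping.lookup q \<nu> * Poly_Mapping.lookup f (\<mu> + \<kappa> - \<nu>)) = 0"
    by (intro sum.neutral ballI zero)
  then have "Poly_Mapping.lookup (q * f) (\<mu> + \<kappa>) = Poly_Mapping.lookup q \<mu> * Poly_Mapping.lookup f \<kappa>"
    by (simp add: lookup_times sum.remove[OF finite_keys \<mu>(1)])
  then show False
    using assms(2,4) \<mu>(1) by (simp add: in_keys_iff)
qed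

text \<open>Cancellability of the divisor makes the quotient unique, so the \<open>THE\<close>
  denotes any quotient that is exhibited.\<close>

lemma exact_quotient_eqI:
  assumes "\<And>p. p * g = 0 \<Longrightarrow> p = 0" and "q * g = f"
  shows "exact_quotient f g = q"
  unfolding exact_quotient_def
proof (rule the_equality)
  fix p assume "p * g = f"
  then have "(p - q) * g = 0" by (simp add: assms(2) left_diff_distrib)
  then have "p - q = 0" by (rule assms(1))
  then show "p = q" by simp
qed (rule assms(2))

lemma Xmon_add: "Xmon (\<mu> + \<nu>) = Xmon \<mu> * Xmon (\<nu> :: 'x::ab_group_add)"
  by (simp add: Xmon_def mult_single)

lemma Xmon_0 [simp]: "Xmon (0 :: 'x::ab_group_add) = 1"
  by (simp add: Xmon_def)

lemma lookup_Xmon: "Poly_Mapping.lookup (Xmon \<mu>) \<nu> = (if \<mu> = \<nu> then 1 else 0)"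
  by (simp add: Xmon_def lookup_single when_def)

lemma Xmon_mult_nat: "Xmon (zmul (int n) \<mu>) = Xmon \<mu> ^ n"
proof (induction n)
  case (Suc n)
  have "zmul (int (Suc n)) \<mu> = \<mu> + zmul (int n) \<mu>"
    by (simp add: zmod.scale_left_distrib)
  then show ?case by (simp add: Xmon_add Suc)
qed simp

section \<open>The divided difference in the Bernstein relation\<close>

context based_root_datum
begin

lemma one_minus_Xmon_regular:
  assumes "\<alpha> \<in> roots D" and "q * (1 - Xmon (- \<alpha>)) = 0"
  shows "q = 0"
proof (rule leading_term_regular[of "form \<alpha>" "1 - Xmon (- \<alpha>)" 0, OF form_additive_right])
  have "\<alpha> \<noteq> 0" using root_neq_0 assms(1) .
  then show "Poly_Mapping.lookup (1 - Xmon (- \<alpha>)) 0 \<noteq> 0"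
    by (simp add: lookup_minus lookup_Xmon)
  fix \<mu> assume "\<mu> \<in> Poly_Mapping.keys (1 - Xmon (- \<alpha>))" "\<mu> \<noteq> 0"
  then have "\<mu> = - \<alpha>"
    by (auto simp: in_keys_iff lookup_minus lookup_Xmon lookup_one when_def split: if_splits)
  then show "form \<alpha> \<mu> < form \<alpha> 0"
    using form_root_pos[OF assms(1)] by simp
qed (rule assms(2))

text \<open>The sign can be moved out only once a quotient is known to exist. For a nonnegative
  pairing it is a finite geometric series in X^(-\<alpha>); otherwise \<mu> and its reflection
  change roles.\<close>

lemma exact_quotient_swap:
  assumes "\<alpha> \<in> roots D"
  shows "exact_quotient (Xmon (reflection D \<alpha> \<mu>) - Xmon \<mu>) (1 - Xmon (- \<alpha>)) =
    - exact_quotient (Xmon \<mu> - Xmon (reflection D \<alpha> \<mu>)) (1 - Xmon (- \<alpha>))"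
proof -
  let ?g = "1 - Xmon (- \<alpha>)"
  have nonneg: "\<exists>q. q * ?g = Xmon \<mu> - Xmon (reflection D \<alpha> \<mu>)"
    if pos: "pairing D \<mu> (coroot D \<alpha>) \<ge> 0" for \<mu>
  proof -
    obtain n where n: "pairing D \<mu> (coroot D \<alpha>) = int n"
      using zero_le_imp_eq_int[OF pos] by blast
    have "Xmon (reflection D \<alpha> \<mu>) = Xmon (\<mu> + zmul (int n) (- \<alpha>))"
      by (simp add: reflection_def n)
    also have "\<dots> = Xmon \<mu> * Xmon (- \<alpha>) ^ n"
      by (simp only: Xmon_add Xmon_mult_nat)
    finally have "Xmon \<mu> - Xmon (reflection D \<alpha> \<mu>) = Xmon \<mu> * (1 - Xmon (- \<alpha>) ^ n)"
      by (simp add: right_diff_distrib)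
    also have "\<dots> = (Xmon \<mu> * (\<Sum>i<n. Xmon (- \<alpha>) ^ i)) * ?g"
      by (simp add: one_diff_power_eq mult_ac)
    finally show ?thesis by metis
  qed
  have "\<exists>q. q * ?g = Xmon \<mu> - Xmon (reflection D \<alpha> \<mu>)"
  proof (cases "pairing D \<mu> (coroot D \<alpha>) \<ge> 0")
    case False
    then have "pairing D (reflection D \<alpha> \<mu>) (coroot D \<alpha>) \<ge> 0"
      by (simp add: reflection_def pairing_root_coroot[OF assms])
    then obtain q where "q * ?g = Xmon (reflection D \<alpha> \<mu>) - Xmon \<mu>"
      using nonneg[of "reflection D \<alpha> \<mu>"] reflection_involution[OF assms] by auto
    then have "- q * ?g = Xmon \<mu> - Xmon (reflection D \<alpha> \<mu>)" by simp
    then show ?thesis ..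
  qed (rule nonneg)
  then obtain q where q: "q * ?g = Xmon \<mu> - Xmon (reflection D \<alpha> \<mu>)" ..
  then have "- q * ?g = Xmon (reflection D \<alpha> \<mu>) - Xmon \<mu>" by simp
  with q show ?thesis
    using exact_quotient_eqI[OF one_minus_Xmon_regular[OF assms]] by metis
qed

end

section \<open>The half sum of positive roots\<close>

locale based_root_datum_rho = based_root_datum D
  for D :: "('x::ab_group_add, 'y::ab_group_add) root_datum" +
  assumes rho_exists: "\<exists>\<rho>. \<rho> + \<rho> = \<Sum>(positive_roots D)"
begin

lemma rho_double: "rho D + rho D = \<Sum>(positive_roots D)"
proof -
  have "\<exists>!\<rho>. \<rho> + \<rho> = \<Sum>(positive_roots D)"
    using rho_exists double_eq_iff by metis
  then show ?thesis
    unfolding rho_def by (rule theI')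
qed

text \<open>The reflection permutes the positive roots other than its simple root, which it negates;
  the claim is this computation for 2\<rho>, halved.\<close>

lemma simple_reflection_rho:
  assumes i: "i \<in> index_set"
  shows "simple_reflection D i (rho D) = rho D - simple_root D i"
proof -
  let ?s = "simple_reflection D i" and ?\<alpha> = "simple_root D i"
  let ?P = "positive_roots D - {?\<alpha>}"
  have s\<alpha>: "?s ?\<alpha> = - ?\<alpha>"
    by (simp add: simple_reflection_def reflection_root simple_root_in[OF i])
  have closed: "?s \<beta> \<in> ?P" if "\<beta> \<in> ?P" for \<beta>
  proof -
    have "?s \<beta> \<noteq> ?\<alpha>"
    proof
      assume "?s \<beta> = ?\<alpha>"
      then have "\<beta> = - ?\<alpha>" using s\<alpha> simple_reflection_involution[OF i] by metis
      then show False using that uminus_positive_root simple_root_positive[OF i] by blast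
    qed
    then show ?thesis using simple_reflection_positive[OF i] that by simp
  qed
  have sum_P: "\<Sum>(positive_roots D) = ?\<alpha> + \<Sum>?P"
    by (rule sum.remove[OF finite_positive_roots simple_root_positive[OF i]])
  have "(\<Sum>\<beta>\<in>?P. ?s \<beta>) = \<Sum>?P"
    by (rule sum.reindex_bij_witness[of _ ?s ?s]) (use closed i in auto)
  then have "?s (rho D) + ?s (rho D) = - ?\<alpha> + \<Sum>?P"
    using additive.sum[OF simple_reflection_additive[of i], of id ?P]
    by (simp add: rho_double sum_P s\<alpha> additive.add[OF simple_reflection_additive]
        flip: additive.add[OF simple_reflection_additive[of i], of "rho D" "rho D"])
  also have "\<dots> = (rho D - ?\<alpha>) + (rho D - ?\<alpha>)"
  proof -
    have "(rho D - ?\<alpha>) + (rho D - ?\<alpha>) = (rho D + rho D) - ?\<alpha> - ?\<alpha>" by simp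
    then show ?thesis unfolding rho_double sum_P by simp
  qed
  finally show ?thesis by (simp only: double_eq_iff)
qed

text \<open>Comparing the two formulas for the reflected \<rho> gives n times the simple root equal
  to that root, and pairing with the coroot gives 2n = 2.\<close>

lemma pairing_rho:
  assumes "i \<in> index_set"
  shows "pairing D (rho D) (coroot D (simple_root D i)) = 1"
proof -
  have "zmul (pairing D (rho D) (coroot D (simple_root D i))) (simple_root D i) = simple_root D i"
    using simple_reflection_rho[OF assms] by (simp add: simple_reflection_def reflection_def)
  then have "pairing D (zmul (pairing D (rho D) (coroot D (simple_root D i))) (simple_root D i))
      (coroot D (simple_root D i)) = pairing D (simple_root D i) (coroot D (simple_root D i))"
    by (rule arg_cong)
  then show ?thesis
    by (simp add: pairing_root_coroot simple_root_in[OF assms])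
qed

lemma form_simple_root_rho: "i \<in> index_set \<Longrightarrow> form (simple_root D i) (rho D) > 0"
  using form_root[OF simple_root_in, of i "rho D"] form_root_pos[OF simple_root_in, of i]
  by (simp add: pairing_rho form_commute)

lemma form_positive_root_rho:
  assumes "\<beta> \<in> positive_roots D"
  shows "form \<beta> (rho D) > 0"
proof -
  obtain c where c: "\<And>i. c i \<ge> (0::int)" "\<beta> = (\<Sum>i\<in>index_set. zmul (c i) (simple_root D i))"
      "\<beta> \<in> roots D"
    using assms by (rule positive_rootE) blast
  have form: "form \<beta> (rho D) = (\<Sum>i\<in>index_set. c i * form (simple_root D i) (rho D))"
    by (simp add: c(2) additive.sum[OF form_additive_left])
  have "\<exists>i\<in>index_set. c i \<noteq> 0"
  proof (rule ccontr)
    assume "\<not> ?thesis"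
    then have "\<beta> = 0" unfolding c(2) by (intro sum.neutral) simp
    then show False using root_neq_0[OF c(3)] by simp
  qed
  then obtain i where "i \<in> index_set" "c i > 0"
    using c(1) by (metis le_less)
  then show ?thesis
    unfolding form using c(1) form_simple_root_rho
    by (intro sum_pos2[of _ i]) (auto intro!: mult_nonneg_nonneg simp: less_imp_le)
qed

section \<open>Dominance and heights along Weyl orbits\<close>

definition dominant :: "'x \<Rightarrow> bool" where
  "dominant x \<longleftrightarrow> (\<forall>i\<in>index_set. pairing D x (coroot D (simple_root D i)) \<ge> 0)"

definition strictly_dominant :: "'x \<Rightarrow> bool" where
  "strictly_dominant x \<longleftrightarrow> (\<forall>i\<in>index_set. pairing D x (coroot D (simple_root D i)) > 0)"

text \<open>Induction along a reduced word that grows on the right; the increase of length is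
  recorded as positivity of a root, the form in which heights use it.\<close>

lemma weyl_length_induct [consumes 1, case_names id step]:
  assumes "w \<in> weyl_group D" and "P id"
    and "\<And>v i. \<lbrakk>v \<in> weyl_group D; i \<in> index_set; v (simple_root D i) \<in> positive_roots D; P v\<rbrakk>
      \<Longrightarrow> P (v \<circ> simple_reflection D i)"
  shows "P w"
  using assms(1)
proof (induction "len w" arbitrary: w rule: less_induct)
  case less
  show ?case
  proof (cases "w = id")
    case False
    with less.prems obtain v i where v: "v \<in> weyl_group D" "i \<in> index_set"
      "w = v \<circ> simple_reflection D i" "len w = len v + 1" "v (simple_root D i) \<in> positive_roots D"
      by (rule last_letter)
    then have "P v" using less.hyps[of v] by simp
    then show ?thesis unfolding v(3) using assms(3) v by blast
  qed (simp only: assms(2))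
qed

lemma form_simple_step:
  assumes "v \<in> weyl_group D" "i \<in> index_set"
  shows "(v \<circ> simple_reflection D i) x =
      v x - zmul (pairing D x (coroot D (simple_root D i))) (v (simple_root D i))"
    and "form ((v \<circ> simple_reflection D i) x) (rho D) = form (v x) (rho D) -
      pairing D x (coroot D (simple_root D i)) * form (v (simple_root D i)) (rho D)"
  by (simp_all add: simple_reflection_def reflection_def additive.diff[OF weyl_group_additive[OF assms(1)]]
      additive_zmul[OF weyl_group_additive[OF assms(1)]])

text \<open>Each letter of a reduced word subtracts a nonnegative multiple of a positive root: a
  zero multiple changes nothing, any other lowers the height.\<close>

lemma dominant_maximal:
  assumes "dominant x" "w \<in> weyl_group D"
  shows "w x = x \<or> form (w x) (rho D) < form x (rho D)"
  using assms(2)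
proof (induction rule: weyl_length_induct)
  case (step v i)
  let ?n = "pairing D x (coroot D (simple_root D i))"
  have n: "?n \<ge> 0" using assms(1) step by (simp add: dominant_def)
  show ?case
  proof (cases "?n = 0")
    case True
    then show ?thesis using step by (simp add: form_simple_step(1) del: comp_apply)
  next
    case False
    then have "?n * form (v (simple_root D i)) (rho D) > 0"
      using n form_positive_root_rho[OF step(3)] by simp
    then show ?thesis
      using step.IH form_simple_step(2)[OF step(1,2), of x] by auto
  qed
qed simp

lemma strictly_dominant_maximal:
  assumes "strictly_dominant x" "w \<in> weyl_group D" "w \<noteq> id"
  shows "form (w x) (rho D) < form x (rho D)"
proof -
  obtain v i where v: "v \<in> weyl_group D" "i \<in> index_set"
      "w = v \<circ> simple_reflection D i" "v (simple_root D i) \<in> positive_roots D"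
    using last_letter[OF assms(2,3)] by metis
  have "dominant x" using assms(1) by (auto simp: dominant_def strictly_dominant_def less_imp_le)
  then have "form (v x) (rho D) \<le> form x (rho D)"
    using dominant_maximal[OF _ v(1)] by fastforce
  moreover have "pairing D x (coroot D (simple_root D i)) * form (v (simple_root D i)) (rho D) > 0"
    using assms(1) v(2) form_positive_root_rho[OF v(4)] by (simp add: strictly_dominant_def)
  ultimately show ?thesis
    using form_simple_step(2)[OF v(1,2), of x] v(3) by simp
qed

text \<open>An orbit point of maximal height is dominant, for a negative pairing would let a simple
  reflection raise it.\<close>

lemma dominant_exists:
  obtains w where "w \<in> weyl_group D" "dominant (w x)"
proof -
  let ?S = "(\<lambda>w. form (w x) (rho D)) ` weyl_group D"
  have "Max ?S \<in> ?S"
    using finite_weyl_group id_in_weyl_group by (intro Max_in) blast+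
  then obtain w where "Max ?S = form (w x) (rho D)" "w \<in> weyl_group D" by (rule imageE)
  then have w: "w \<in> weyl_group D" "form (w x) (rho D) = Max ?S" by simp_all
  have "pairing D (w x) (coroot D (simple_root D i)) \<ge> 0" if i: "i \<in> index_set" for i
  proof -
    have "simple_reflection D i \<circ> w \<in> weyl_group D"
      using weyl_group_comp_simple(2)[OF w(1) i] .
    then have "form ((simple_reflection D i \<circ> w) x) (rho D) \<le> form (w x) (rho D)"
      unfolding w(2) using finite_weyl_group by (intro Max_ge) blast+
    then have "pairing D (w x) (coroot D (simple_root D i)) * form (simple_root D i) (rho D) \<ge> 0"
      by (simp add: simple_reflection_def reflection_def)
    then show ?thesis
      using form_simple_root_rho[OF i] by (simp add: zero_le_mult_iff)
  qed
  then show ?thesis using that w(1) by (simp add: dominant_def)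
qed

end

lemma of_int_times_Xmon: "of_int k * Xmon \<mu> = Poly_Mapping.single (\<mu> :: 'x::ab_group_add) (of_int k)"
  by (simp add: Xmon_def mult_single flip: single_of_int)

section \<open>Alternants and Weyl characters\<close>

context based_root_datum_rho
begin

definition alternant :: "'x \<Rightarrow> 'x group_alg" where
  "alternant \<nu> = (\<Sum>w\<in>weyl_group D. of_int (lattice_det w) * Xmon (w \<nu>))"

text \<open>The dot action differs from the linear one by the unit X^(-\<rho>), common to numerator
  and denominator of the character.\<close>

lemma weyl_numerator_eq: "weyl_numerator D lam = alternant (lam + rho D) * Xmon (- rho D)"
  by (simp add: weyl_numerator_def alternant_def dot_action_def sum_distrib_right mult.assoc
      flip: Xmon_add)

lemma lookup_alternant:
  "Poly_Mapping.lookup (alternant \<nu>) \<mu> =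
    (\<Sum>w\<in>weyl_group D. if w \<nu> = \<mu> then of_int (lattice_det w) else 0)"
  by (simp add: alternant_def lookup_sum of_int_times_Xmon lookup_single when_def)

lemma alternant_simple_reflection:
  assumes i: "i \<in> index_set"
  shows "alternant (simple_reflection D i \<nu>) = - alternant \<nu>"
proof -
  let ?s = "simple_reflection D i"
  have "alternant (?s \<nu>) = (\<Sum>w\<in>weyl_group D. of_int (lattice_det (w \<circ> ?s)) * Xmon ((w \<circ> ?s) (?s \<nu>)))"
    unfolding alternant_def
    by (rule sum.reindex_bij_witness[of _ "\<lambda>w. w \<circ> ?s" "\<lambda>w. w \<circ> ?s"])
      (simp_all only: comp_assoc simple_reflection_comp[OF i] comp_id weyl_group_comp_simple(1) i)
  also have "\<dots> = - alternant \<nu>"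
    unfolding alternant_def sum_negf[symmetric]
  proof (rule sum.cong[OF refl])
    fix w assume "w \<in> weyl_group D"
    then show "of_int (lattice_det (w \<circ> ?s)) * Xmon ((w \<circ> ?s) (?s \<nu>)) = - (of_int (lattice_det w) * Xmon (w \<nu>))"
      using i by (simp only: lattice_det_simple) simp
  qed
  finally show ?thesis .
qed

text \<open>The sign is left open because divisibility by an alternant with a symmetric quotient is
  stable under negation.\<close>

lemma alternant_weyl_group:
  assumes "w \<in> weyl_group D"
  shows "alternant (w \<nu>) = alternant \<nu> \<or> alternant (w \<nu>) = - alternant \<nu>"
proof -
  have "\<forall>\<nu>. alternant (w \<nu>) = alternant \<nu> \<or> alternant (w \<nu>) = - alternant \<nu>"
    using assms
  proof (induction rule: weyl_length_induct)
    case (step v i)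
    show ?case
    proof
      fix \<nu>
      show "alternant ((v \<circ> simple_reflection D i) \<nu>) = alternant \<nu> \<or>
          alternant ((v \<circ> simple_reflection D i) \<nu>) = - alternant \<nu>"
        using step.IH[rule_format, of "simple_reflection D i \<nu>"]
        by (auto simp: alternant_simple_reflection[OF step(2)])
    qed
  qed simp
  then show ?thesis ..
qed

lemma alternant_singular:
  assumes "i \<in> index_set" "pairing D \<nu> (coroot D (simple_root D i)) = 0"
  shows "alternant \<nu> = 0"
proof -
  have "simple_reflection D i \<nu> = \<nu>"
    by (simp add: simple_reflection_def reflection_def assms(2))
  then have "alternant \<nu> = - alternant \<nu>"
    using alternant_simple_reflection[OF assms(1), of \<nu>] by simp
  then have "Poly_Mapping.lookup (alternant \<nu>) \<mu> = - Poly_Mapping.lookup (alternant \<nu>) \<mu>" for \<mu>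
    by (metis lookup_uminus)
  then have "Poly_Mapping.lookup (alternant \<nu>) \<mu> = 0" for \<mu>
    by (simp add: equal_neg_zero)
  then show ?thesis by (simp add: poly_mapping_eqI)
qed

lemma strictly_dominant_rho: "strictly_dominant (rho D)"
  by (simp add: strictly_dominant_def pairing_rho)

text \<open>By strict dominance only the identity fixes \<rho>, so X^\<rho> has coefficient 1, and
  all other exponents have smaller height.\<close>

lemma alternant_rho_regular:
  assumes "q * alternant (rho D) = 0"
  shows "q = 0"
proof (rule leading_term_regular[of "\<lambda>x. form x (rho D)" "alternant (rho D)" "rho D",
      OF form_additive_left])
  have "w (rho D) \<noteq> rho D" if "w \<in> weyl_group D - {id}" for w
    using strictly_dominant_maximal[OF strictly_dominant_rho, of w] that by auto
  then have "(\<Sum>w\<in>weyl_group D - {id}. if w (rho D) = rho D then of_int (lattice_det w) else 0 :: laurent) = 0"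
    by (intro sum.neutral) simp
  then show "Poly_Mapping.lookup (alternant (rho D)) (rho D) \<noteq> 0"
    unfolding lookup_alternant sum.remove[OF finite_weyl_group id_in_weyl_group]
    by (simp add: lattice_det_id)
  fix \<mu> assume \<mu>: "\<mu> \<in> Poly_Mapping.keys (alternant (rho D))" "\<mu> \<noteq> rho D"
  from \<mu>(1) obtain w where "w \<in> weyl_group D"
      "(if w (rho D) = \<mu> then of_int (lattice_det w) else 0 :: laurent) \<noteq> 0"
    unfolding in_keys_iff lookup_alternant by (rule sum.not_neutral_contains_not_neutral)
  then have "w \<in> weyl_group D" "w (rho D) = \<mu>" by (simp_all split: if_splits)
  moreover from this have "w \<noteq> id" using \<mu>(2) by (metis id_apply)
  ultimately show "form \<mu> (rho D) < form (rho D) (rho D)"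
    using strictly_dominant_maximal[OF strictly_dominant_rho, of w] \<mu>(2) by auto
qed (rule assms)

section \<open>Invariants and divisibility of alternants\<close>

definition symmetric :: "'x group_alg \<Rightarrow> bool" where
  "symmetric q \<longleftrightarrow>
    (\<forall>i\<in>index_set. \<forall>\<mu>. Poly_Mapping.lookup q (simple_reflection D i \<mu>) = Poly_Mapping.lookup q \<mu>)"

lemma symmetric_0: "symmetric 0"
  and symmetric_uminus: "symmetric p \<Longrightarrow> symmetric (- p)"
  and symmetric_diff: "symmetric p \<Longrightarrow> symmetric q \<Longrightarrow> symmetric (p - q)"
  by (simp_all add: symmetric_def lookup_minus)

lemma symmetric_sum: "(\<And>x. x \<in> A \<Longrightarrow> symmetric (f x)) \<Longrightarrow> symmetric (sum f A)"
  by (simp add: symmetric_def lookup_sum)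

definition orbit :: "'x \<Rightarrow> 'x set" where
  "orbit lam = (\<lambda>w. w lam) ` weyl_group D"

lemma finite_orbit: "finite (orbit lam)"
  by (simp add: orbit_def finite_weyl_group)

lemma in_orbit: "lam \<in> orbit lam"
  unfolding orbit_def by (rule image_eqI[OF _ id_in_weyl_group]) simp

lemma weyl_group_in_orbit: "w \<in> weyl_group D \<Longrightarrow> \<mu> \<in> orbit lam \<Longrightarrow> w \<mu> \<in> orbit lam"
proof -
  assume w: "w \<in> weyl_group D" and "\<mu> \<in> orbit lam"
  then obtain v where "v \<in> weyl_group D" "\<mu> = v lam" unfolding orbit_def by blast
  then show ?thesis
    unfolding orbit_def using weyl_group_comp[OF w] by (intro image_eqI[of _ _ "w \<circ> v"]) simp_all
qed

text \<open>A sum over orbit points rather than group elements: every monomial has coefficient 1,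
  whatever the stabilizer of \<open>lam\<close>.\<close>

definition orbit_sum :: "'x \<Rightarrow> 'x group_alg" where
  "orbit_sum lam = (\<Sum>\<mu>\<in>orbit lam. Xmon \<mu>)"

lemma symmetric_orbit_sum: "symmetric (orbit_sum lam)"
proof -
  have "simple_reflection D i \<mu> \<in> orbit lam \<longleftrightarrow> \<mu> \<in> orbit lam" if i: "i \<in> index_set" for i \<mu>
  proof -
    have "simple_reflection D i \<in> weyl_group D"
      using word_action_in_weyl_group[of "[i]"] i by simp
    then show ?thesis
      using weyl_group_in_orbit simple_reflection_involution[OF i] by metis
  qed
  moreover have "Poly_Mapping.lookup (orbit_sum lam) \<mu> = (if \<mu> \<in> orbit lam then 1 else 0)" for \<mu>
    by (simp add: orbit_sum_def lookup_sum lookup_Xmon finite_orbit)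
  ultimately show ?thesis by (simp add: symmetric_def)
qed

text \<open>For each fixed \<open>w\<close> the orbit is permuted by \<open>w\<close>, so \<mu> may
  be replaced by \<open>w \<mu>\<close>, and \<open>w\<close> then acts on the whole exponent \<mu>
  + \<nu>.\<close>

lemma orbit_sum_times_alternant:
  "orbit_sum lam * alternant \<nu> = (\<Sum>\<mu>\<in>orbit lam. alternant (\<mu> + \<nu>))"
proof -
  have "orbit_sum lam * alternant \<nu> =
      (\<Sum>w\<in>weyl_group D. \<Sum>\<mu>\<in>orbit lam. of_int (lattice_det w) * Xmon (\<mu> + w \<nu>))"
    unfolding orbit_sum_def alternant_def sum_product
    by (subst sum.swap) (simp add: Xmon_add mult_ac)
  also have "\<dots> = (\<Sum>w\<in>weyl_group D. \<Sum>\<mu>\<in>orbit lam. of_int (lattice_det w) * Xmon (w (\<mu> + \<nu>)))"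
  proof (rule sum.cong[OF refl])
    fix w assume w: "w \<in> weyl_group D"
    obtain v where v: "v \<in> weyl_group D" "v \<circ> w = id" "w \<circ> v = id"
      using weyl_group_inverse[OF w] .
    show "(\<Sum>\<mu>\<in>orbit lam. of_int (lattice_det w) * Xmon (\<mu> + w \<nu>)) =
        (\<Sum>\<mu>\<in>orbit lam. of_int (lattice_det w) * Xmon (w (\<mu> + \<nu>)))"
      by (rule sum.reindex_bij_witness[of _ w v])
        (use v w weyl_group_in_orbit in \<open>auto simp: fun_eq_iff additive.add[OF weyl_group_additive[OF w]]\<close>)
  qed
  also have "\<dots> = (\<Sum>\<mu>\<in>orbit lam. alternant (\<mu> + \<nu>))"
    unfolding alternant_def by (rule sum.swap)
  finally show ?thesis .
qed

lemma alternant_quotient: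
  assumes "strictly_dominant \<nu>"
  shows "\<exists>q. symmetric q \<and> q * alternant (rho D) = alternant \<nu>"
  using assms
proof (induction "nat (form \<nu> \<nu>)" arbitrary: \<nu> rule: less_induct)
  case less
  let ?\<rho> = "rho D"
  define lam where "lam = \<nu> - ?\<rho>"
  have \<nu>: "\<nu> = lam + ?\<rho>" by (simp add: lam_def)
  \<comment> \<open>By integrality: a positive pairing is at least 1, which is exactly the pairing
    of \<rho>.\<close>
  have dom: "dominant lam"
    using less.prems by (auto simp: dominant_def strictly_dominant_def lam_def pairing_rho)
  have "\<exists>q. symmetric q \<and> q * alternant ?\<rho> = alternant (\<mu> + ?\<rho>)" if \<mu>: "\<mu> \<in> orbit lam - {lam}" for \<mu>
  proof -
    obtain u where u: "u \<in> weyl_group D" "\<mu> = u lam" "u lam \<noteq> lam" using \<mu> by (auto simp: orbit_def)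
    have "form \<mu> ?\<rho> < form lam ?\<rho>" "form \<mu> \<mu> = form lam lam"
      using dominant_maximal[OF dom u(1)] u by (simp_all add: weyl_group_form)
    \<comment> \<open>Since \<mu> and \<open>lam\<close> have equal norm, only the cross terms with
      \<rho> differ, and these are heights.\<close>
    then have lt: "form (\<mu> + ?\<rho>) (\<mu> + ?\<rho>) < form \<nu> \<nu>"
      unfolding \<nu> using form_commute[of ?\<rho> \<mu>] form_commute[of ?\<rho> lam] by simp
    obtain w where w: "w \<in> weyl_group D" "dominant (w (\<mu> + ?\<rho>))"
      using dominant_exists .
    let ?y = "w (\<mu> + ?\<rho>)"
    have pm: "alternant (\<mu> + ?\<rho>) = alternant ?y \<or> alternant (\<mu> + ?\<rho>) = - alternant ?y"
      using alternant_weyl_group[OF w(1), of "\<mu> + ?\<rho>"] by fastforce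
    have "\<exists>q. symmetric q \<and> q * alternant ?\<rho> = alternant ?y"
    proof (cases "strictly_dominant ?y")
      case True
      have "nat (form ?y ?y) < nat (form \<nu> \<nu>)"
        using lt form_nonneg[of "\<mu> + ?\<rho>"] by (simp only: weyl_group_form[OF w(1)])
      then show ?thesis using less.hyps[OF _ True] by blast
    next
      case False
      then obtain i where "i \<in> index_set" "pairing D ?y (coroot D (simple_root D i)) = 0"
        using w(2) unfolding strictly_dominant_def dominant_def by (metis le_less)
      then have "alternant ?y = 0" by (rule alternant_singular)
      then show ?thesis using symmetric_0 by (metis mult_zero_left)
    qed
    then show ?thesis
      using pm symmetric_uminus by (metis mult_minus_left)
  qed
  then obtain Q where Q: "\<And>\<mu>. \<mu> \<in> orbit lam - {lam} \<Longrightarrow>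
      symmetric (Q \<mu>) \<and> Q \<mu> * alternant ?\<rho> = alternant (\<mu> + ?\<rho>)"
    by metis
  have "orbit_sum lam * alternant ?\<rho> = alternant \<nu> + (\<Sum>\<mu>\<in>orbit lam - {lam}. alternant (\<mu> + ?\<rho>))"
    unfolding orbit_sum_times_alternant sum.remove[OF finite_orbit in_orbit]
    by (simp flip: \<nu>)
  also have "(\<Sum>\<mu>\<in>orbit lam - {lam}. alternant (\<mu> + ?\<rho>)) = (\<Sum>\<mu>\<in>orbit lam - {lam}. Q \<mu>) * alternant ?\<rho>"
    unfolding sum_distrib_right using Q by (intro sum.cong) simp_all
  finally have "(orbit_sum lam - (\<Sum>\<mu>\<in>orbit lam - {lam}. Q \<mu>)) * alternant ?\<rho> = alternant \<nu>"
    by (simp add: left_diff_distrib)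
  moreover have "symmetric (orbit_sum lam - (\<Sum>\<mu>\<in>orbit lam - {lam}. Q \<mu>))"
    using Q by (intro symmetric_diff symmetric_orbit_sum symmetric_sum) blast
  ultimately show ?case by blast
qed

text \<open>Turns the definite description into a usable element: existence is
  \<open>alternant_quotient\<close>, uniqueness is \<open>alternant_rho_regular\<close>.\<close>

lemma weyl_character:
  assumes "lam \<in> dominant_weights D"
  shows "symmetric (weyl_character D lam)"
    and "weyl_character D lam * alternant (rho D) = alternant (lam + rho D)"
proof -
  have "strictly_dominant (lam + rho D)"
    using assms by (simp add: dominant_weights_def strictly_dominant_def index_set_def)
  then obtain q where q: "symmetric q" "q * alternant (rho D) = alternant (lam + rho D)"
    using alternant_quotient by blast
  have "weyl_character D lam = q"
    unfolding weyl_character_def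
  proof (rule exact_quotient_eqI)
    show "q * weyl_numerator D 0 = weyl_numerator D lam"
      using q(2) by (simp add: weyl_numerator_eq flip: mult.assoc)
    fix p assume "p * weyl_numerator D 0 = 0"
    \<comment> \<open>Multiplication by X^\<rho> undoes the shift of the dot action.\<close>
    then have "p * alternant (rho D) * (Xmon (- rho D) * Xmon (rho D)) = 0"
      by (simp add: weyl_numerator_eq flip: mult.assoc)
    then have "p * alternant (rho D) = 0"
      by (simp flip: Xmon_add)
    then show "p = 0" by (rule alternant_rho_regular)
  qed
  with q show "symmetric (weyl_character D lam)"
    "weyl_character D lam * alternant (rho D) = alternant (lam + rho D)" by simp_all
qed

end

section \<open>The affine Hecke algebra\<close>

text \<open>Each pair of the involution is listed by its shorter member. It is applied to left and
  right multiplication by a simple reflection.\<close>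

lemma sum_involution_pairs:
  fixes f :: "'a \<Rightarrow> 'b::comm_monoid_add" and l :: "'a \<Rightarrow> nat"
  assumes "finite W" and \<sigma>: "\<And>w. w \<in> W \<Longrightarrow> \<sigma> w \<in> W \<and> \<sigma> (\<sigma> w) = w"
    and l: "\<And>w. w \<in> W \<Longrightarrow> l (\<sigma> w) = l w + 1 \<or> l w = l (\<sigma> w) + 1"
  shows "sum f W = (\<Sum>w\<in>{w \<in> W. l (\<sigma> w) = l w + 1}. f w + f (\<sigma> w))"
proof -
  let ?P = "{w \<in> W. l (\<sigma> w) = l w + 1}" and ?Q = "{w \<in> W. l w = l (\<sigma> w) + 1}"
  have "W = ?P \<union> ?Q" using l by blast
  moreover have "sum f (?P \<union> ?Q) = sum f ?P + sum f ?Q"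
    by (rule sum.union_disjoint) (use assms(1) in auto)
  ultimately have "sum f W = sum f ?P + sum f ?Q" by simp
  also have "sum f ?Q = (\<Sum>w\<in>?P. f (\<sigma> w))"
    by (rule sum.reindex_bij_witness[of _ \<sigma> \<sigma>]) (use \<sigma> in auto)
  finally show ?thesis by (simp add: sum.distrib)
qed

lemma (in based_root_datum) len_simple_left:
  assumes "w \<in> weyl_group D" "i \<in> index_set"
  shows "len (simple_reflection D i \<circ> w) = len w + 1 \<or> len w = len (simple_reflection D i \<circ> w) + 1"
proof -
  obtain xs where xs: "xs \<in> words" "w = word_action D xs"
    using assms(1) unfolding weyl_group_eq by blast
  have "word_action D (rev xs) \<in> weyl_group D"
    using word_action_in_weyl_group xs(1) by simp
  from len_simple_right[OF this assms(2)]
  have "len (word_action D (rev xs) \<circ> simple_reflection D i) = len (word_action D (rev xs)) + 1 \<or>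
      len (word_action D (rev xs)) = len (word_action D (rev xs) \<circ> simple_reflection D i) + 1"
    by (auto split: if_splits)
  moreover have "len (word_action D (rev xs) \<circ> simple_reflection D i) = len (simple_reflection D i \<circ> w)"
    using len_rev[of "i # xs"] xs assms(2) by simp
  ultimately show ?thesis
    using len_rev[OF xs(1)] xs(2) by simp
qed

lemma t_half_mult: "t_half * t_neg_half = 1"
  by (simp add: t_half_def t_neg_half_def mult_single flip: single_one)

locale affine_hecke_algebra_rho = affine_hecke_algebra D H + based_root_datum_rho D
  for D :: "('x::ab_group_add, 'y::ab_group_add) root_datum"
    and H :: "('x, 'h::ring_1) hecke_data"
begin

lemma scale_torsion_free:
  assumes "c \<noteq> 0" "scale H c x = 0"
  shows "x = 0"
  using torsion_free_if_basis[OF basis_independent basis_span, of c x] assms by auto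

subsection \<open>The embedding of the group algebra\<close>

abbreviation embed :: "'x group_alg \<Rightarrow> 'h" where
  "embed \<equiv> group_alg_embed H"

lemma embed_superset:
  assumes "finite S" "Poly_Mapping.keys f \<subseteq> S"
  shows "embed f = (\<Sum>\<mu>\<in>S. scale H (Poly_Mapping.lookup f \<mu>) (X_elt H \<mu>))"
  unfolding group_alg_embed_def
  by (rule sum.mono_neutral_left) (use assms in \<open>auto simp: in_keys_iff\<close>)

lemma embed_additive: "additive embed"
proof
  fix f g :: "'x group_alg"
  let ?S = "Poly_Mapping.keys f \<union> Poly_Mapping.keys g"
  have "embed h = (\<Sum>\<mu>\<in>?S. scale H (Poly_Mapping.lookup h \<mu>) (X_elt H \<mu>))"
    if "h \<in> {f, g, f + g}" for h
    by (rule embed_superset) (use that Poly_Mapping.keys_add[of f g] in auto)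
  then show "embed (f + g) = embed f + embed g"
    by (simp add: lookup_add scale_left_distrib sum.distrib)
qed

lemma embed_single: "embed (Poly_Mapping.single \<mu> c) = scale H c (X_elt H \<mu>)"
  by (subst embed_superset[of "{\<mu>}"]) simp_all

lemma scale_mult: "scale H c x * scale H d y = scale H (c * d) (x * y)"
  by (simp add: mult.commute flip: scale_mult_left scale_mult_right)

lemma embed_mult: "embed (f * g) = embed f * embed g"
proof -
  let ?f = "Poly_Mapping.lookup f" and ?g = "Poly_Mapping.lookup g"
  have "f * g = (\<Sum>\<mu>\<in>Poly_Mapping.keys f. Poly_Mapping.single \<mu> (?f \<mu>)) *
      (\<Sum>\<nu>\<in>Poly_Mapping.keys g. Poly_Mapping.single \<nu> (?g \<nu>))"
    by (rule arg_cong2[of f _ g _ "(*)", OF group_alg_expansion group_alg_expansion])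
  also have "\<dots> = (\<Sum>\<mu>\<in>Poly_Mapping.keys f. \<Sum>\<nu>\<in>Poly_Mapping.keys g.
      Poly_Mapping.single (\<mu> + \<nu>) (?f \<mu> * ?g \<nu>))"
    by (simp add: sum_product mult_single)
  finally have "embed (f * g) = (\<Sum>\<mu>\<in>Poly_Mapping.keys f. \<Sum>\<nu>\<in>Poly_Mapping.keys g.
      embed (Poly_Mapping.single (\<mu> + \<nu>) (?f \<mu> * ?g \<nu>)))"
    by (simp only: additive.sum[OF embed_additive])
  also have "\<dots> = embed f * embed g"
    by (simp only: embed_single X_add group_alg_embed_def[of H f] group_alg_embed_def[of H g]
        sum_product scale_mult)
  finally show ?thesis .
qed

subsection \<open>The basis elements \<open>T\<^sub>w\<close>\<close>

text \<open>\<open>T_elt\<close> picks an arbitrary reduced word; Matsumoto's theorem makes the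
  choice immaterial.\<close>

lemma T_elt_reduced:
  assumes "reduced xs"
  shows "T_elt D H (word_action D xs) = prod_list (map (T_gen H) xs)"
proof -
  define ys where "ys = (SOME ys. reduced_word D (word_action D xs) ys)"
  have "reduced_word D (word_action D xs) ys"
    unfolding ys_def by (rule someI[of _ xs]) (simp add: reduced_word_iff_reduced assms)
  then have ys: "reduced ys" "word_action D ys = word_action D xs"
    by (simp_all add: reduced_word_iff_reduced)
  have "prod_list (map (T_gen H) (alternating_word (coxeter_order D i j) i j)) =
      prod_list (map (T_gen H) (alternating_word (coxeter_order D i j) j i))"
    if "i \<in> index_set" "j \<in> index_set" "i \<noteq> j" for i j
    using braid[of i j] that by (simp add: alternating_prod_eq_word index_set_def)
  from matsumoto[OF this ys(1) assms ys(2)]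
  have "prod_list (map (T_gen H) ys) = prod_list (map (T_gen H) xs)" .
  then show ?thesis by (simp add: T_elt_def ys_def)
qed

lemma T_elt_simple_right:
  assumes "w \<in> weyl_group D" "i \<in> index_set" "len (w \<circ> simple_reflection D i) = len w + 1"
  shows "T_elt D H (w \<circ> simple_reflection D i) = T_elt D H w * T_gen H i"
proof -
  obtain xs where xs: "reduced xs" "word_action D xs = w"
    using reduced_word_exists[OF assms(1)] unfolding reduced_word_iff_reduced by blast
  have eq: "word_action D (xs @ [i]) = w \<circ> simple_reflection D i"
    by (simp only: word_action_append word_action_Cons word_action_Nil comp_id xs(2))
  have "reduced (xs @ [i])"
    unfolding reduced_def eq using xs assms(2,3) by (simp add: reduced_def)
  from T_elt_reduced[OF this] show ?thesis
    unfolding eq using T_elt_reduced[OF xs(1)] xs(2) by simp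
qed

lemma T_elt_simple_left:
  assumes "w \<in> weyl_group D" "i \<in> index_set" "len (simple_reflection D i \<circ> w) = len w + 1"
  shows "T_elt D H (simple_reflection D i \<circ> w) = T_gen H i * T_elt D H w"
proof -
  obtain xs where xs: "reduced xs" "word_action D xs = w"
    using reduced_word_exists[OF assms(1)] unfolding reduced_word_iff_reduced by blast
  have eq: "word_action D (i # xs) = simple_reflection D i \<circ> w"
    by (simp only: word_action_Cons xs(2))
  have "reduced (i # xs)"
    unfolding reduced_def eq using xs assms(2,3) by (simp add: reduced_def)
  from T_elt_reduced[OF this] show ?thesis
    unfolding eq using T_elt_reduced[OF xs(1)] xs(2) by simp
qed

lemma T_gen_square:
  assumes "i \<in> index_set"
  shows "T_gen H i * T_gen H i = scale H (t_half - t_neg_half) (T_gen H i) + 1"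
proof -
  let ?T = "T_gen H i"
  have l: "scale H c 1 * x = scale H c x" and r: "x * scale H c 1 = scale H c x" for c x
    by (simp_all flip: scale_mult_left scale_mult_right)
  have "(?T - scale H t_half 1) * (?T + scale H t_neg_half 1) = 0"
    using quadratic assms by (simp add: index_set_def)
  then show ?thesis
    by (simp add: algebra_simps l r scale_left_diff_distrib t_half_mult scale_scale mult.commute)
qed

text \<open>The two roots \<open>t\<^bsup>1/2\<^esup>\<close> and \<open>-t\<^bsup>-1/2\<^esup>\<close> of the quadratic relation give the two
  one-dimensional characters of the finite Hecke algebra; \<open>\<one>\<^sub>0\<close> and \<open>\<epsilon>\<^sub>0\<close> are
  multiples of the corresponding sums.\<close>

definition char_sum :: "laurent \<Rightarrow> 'h" where
  "char_sum c = (\<Sum>z\<in>weyl_group D. scale H (c ^ len z) (T_elt D H z))"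

text \<open>On the span of T_w and T_i T_w, with w the shorter of its pair, the vector c^n T_w +
  c^(n+1) T_i T_w, where n is the length of w, is an eigenvector of T_i for \<open>c\<close>,
  precisely because \<open>c\<close> solves the quadratic relation.\<close>

lemma char_sum_T_gen:
  assumes c: "c * c = (t_half - t_neg_half) * c + 1" and i: "i \<in> index_set"
  shows "T_gen H i * char_sum c = scale H c (char_sum c)"
    and "char_sum c * T_gen H i = scale H c (char_sum c)"
proof -
  let ?T = "T_gen H i" and ?s = "simple_reflection D i" and ?d = "t_half - t_neg_half"
  let ?f = "\<lambda>z. scale H (c ^ len z) (T_elt D H z)"
  have pow: "c ^ n + c ^ (n + 1) * ?d = c * c ^ (n + 1)" for n
  proof -
    have "c * c ^ (n + 1) = (c * c) * c ^ n" by (simp add: mult_ac)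
    also have "\<dots> = c ^ n + c ^ (n + 1) * ?d" unfolding c by (simp add: algebra_simps)
    finally show ?thesis ..
  qed
  \<comment> \<open>Here \<open>x\<close> stands for T_w and \<open>y\<close> for its product with
    T_i, on either side.\<close>
  have combine: "scale H (c ^ n) y + scale H (c ^ (n + 1)) (scale H ?d y + x) =
      scale H c (scale H (c ^ n) x + scale H (c ^ (n + 1)) y)" for n x y
  proof -
    have "scale H (c ^ n) y + scale H (c ^ (n + 1)) (scale H ?d y + x) =
        scale H (c ^ n + c ^ (n + 1) * ?d) y + scale H (c ^ (n + 1)) x"
      by (simp only: scale_right_distrib scale_scale scale_left_distrib add.assoc)
    also have "\<dots> = scale H c (scale H (c ^ n) x + scale H (c ^ (n + 1)) y)"
      unfolding pow by (simp add: scale_right_distrib scale_scale add.commute)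
    finally show ?thesis .
  qed
  let ?P = "{w \<in> weyl_group D. len (?s \<circ> w) = len w + 1}"
  have sum: "char_sum c = (\<Sum>w\<in>?P. ?f w + ?f (?s \<circ> w))"
    unfolding char_sum_def
  proof (rule sum_involution_pairs[OF finite_weyl_group])
    fix w assume w: "w \<in> weyl_group D"
    show "?s \<circ> w \<in> weyl_group D \<and> ?s \<circ> (?s \<circ> w) = w"
      using weyl_group_comp_simple(2)[OF w i] simple_reflection_comp(2)[OF i] by blast
    show "len (?s \<circ> w) = len w + 1 \<or> len w = len (?s \<circ> w) + 1"
      by (rule len_simple_left[OF w i])
  qed
  have "?T * (?f w + ?f (?s \<circ> w)) = scale H c (?f w + ?f (?s \<circ> w))" if "w \<in> ?P" for w
  proof -
    have w: "w \<in> weyl_group D" "len (?s \<circ> w) = len w + 1" using that by simp_all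
    let ?n = "len w"
    have "?T * (?f w + ?f (?s \<circ> w)) =
        scale H (c ^ ?n) (?T * T_elt D H w) + scale H (c ^ (?n + 1)) ((?T * ?T) * T_elt D H w)"
      unfolding w(2) T_elt_simple_left[OF w(1) i w(2)]
      by (simp only: distrib_left mult.assoc flip: scale_mult_right)
    also have "(?T * ?T) * T_elt D H w = scale H ?d (?T * T_elt D H w) + T_elt D H w"
      unfolding T_gen_square[OF i] by (simp add: distrib_right scale_mult_left)
    finally show ?thesis
      unfolding combine unfolding w(2) T_elt_simple_left[OF w(1) i w(2)] .
  qed
  then show "?T * char_sum c = scale H c (char_sum c)"
    unfolding sum sum_distrib_left scale_sum_right by (intro sum.cong) simp_all
  let ?Q = "{w \<in> weyl_group D. len (w \<circ> ?s) = len w + 1}"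
  have len: "len (w \<circ> ?s) = len w + 1 \<or> len w = len (w \<circ> ?s) + 1" if "w \<in> weyl_group D" for w
    using len_simple_right[OF that i] by (auto split: if_splits)
  have sum: "char_sum c = (\<Sum>w\<in>?Q. ?f w + ?f (w \<circ> ?s))"
    unfolding char_sum_def
  proof (rule sum_involution_pairs[OF finite_weyl_group])
    fix w assume w: "w \<in> weyl_group D"
    show "w \<circ> ?s \<in> weyl_group D \<and> w \<circ> ?s \<circ> ?s = w"
      using weyl_group_comp_simple(1)[OF w i]
      by (simp only: comp_assoc simple_reflection_comp(1)[OF i] comp_id simp_thms)
    show "len (w \<circ> ?s) = len w + 1 \<or> len w = len (w \<circ> ?s) + 1"
      by (rule len[OF w])
  qed
  have "(?f w + ?f (w \<circ> ?s)) * ?T = scale H c (?f w + ?f (w \<circ> ?s))" if "w \<in> ?Q" for w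
  proof -
    have w: "w \<in> weyl_group D" "len (w \<circ> ?s) = len w + 1" using that by simp_all
    let ?n = "len w"
    have "(?f w + ?f (w \<circ> ?s)) * ?T =
        scale H (c ^ ?n) (T_elt D H w * ?T) + scale H (c ^ (?n + 1)) (T_elt D H w * (?T * ?T))"
      unfolding w(2) T_elt_simple_right[OF w(1) i w(2)]
      by (simp only: distrib_right mult.assoc flip: scale_mult_left)
    also have "T_elt D H w * (?T * ?T) = scale H ?d (T_elt D H w * ?T) + T_elt D H w"
      unfolding T_gen_square[OF i] by (simp add: distrib_left scale_mult_right)
    finally show ?thesis
      unfolding combine unfolding w(2) T_elt_simple_right[OF w(1) i w(2)] .
  qed
  then show "char_sum c * ?T = scale H c (char_sum c)"
    unfolding sum sum_distrib_right scale_sum_right by (intro sum.cong) simp_all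
qed

lemma one0_eq: "one0 D H = scale H (t_neg_half ^ len (longest_element D)) (char_sum t_half)"
  and eps0_eq: "eps0 D H = scale H ((- t_half) ^ len (longest_element D)) (char_sum (- t_neg_half))"
  by (simp_all add: one0_def eps0_def char_sum_def)

lemma T_gen_one0:
  assumes "i \<in> index_set"
  shows "T_gen H i * one0 D H = scale H t_half (one0 D H)"
proof -
  have "t_half * t_half = (t_half - t_neg_half) * t_half + 1"
    using t_half_mult by (simp add: algebra_simps)
  from char_sum_T_gen(1)[OF this assms] show ?thesis
    by (simp add: one0_eq mult.commute flip: scale_mult_right)
qed

lemma eps0_T_gen:
  assumes "i \<in> index_set"
  shows "eps0 D H * T_gen H i = scale H (- t_neg_half) (eps0 D H)"
proof -
  have "- t_neg_half * - t_neg_half = (t_half - t_neg_half) * - t_neg_half + 1"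
    using t_half_mult by (simp add: algebra_simps)
  from char_sum_T_gen(2)[OF this assms] show ?thesis
    unfolding eps0_eq scale_mult_left[symmetric] by (simp only: scale_scale mult.commute)
qed

subsection \<open>Commutation with symmetric elements\<close>

text \<open>The two Bernstein relations have opposite correction terms by
  \<open>exact_quotient_swap\<close>, which cancel in the sum.\<close>

lemma T_gen_commutes_orbit:
  assumes i: "i \<in> index_set"
  shows "T_gen H i * (X_elt H \<mu> + X_elt H (simple_reflection D i \<mu>)) =
    (X_elt H \<mu> + X_elt H (simple_reflection D i \<mu>)) * T_gen H i"
proof -
  let ?s = "simple_reflection D i" and ?T = "T_gen H i"
  let ?q = "\<lambda>\<mu>. embed (exact_quotient (Xmon \<mu> - Xmon (?s \<mu>)) (1 - Xmon (- simple_root D i)))"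
  let ?d = "t_half - t_neg_half"
  have B: "?T * X_elt H \<nu> = X_elt H (?s \<nu>) * ?T + scale H ?d (?q \<nu>)" for \<nu>
    using bernstein[of i \<nu>] i by (simp add: index_set_def algebra_simps)
  have swap: "?q (?s \<mu>) = - ?q \<mu>"
    using exact_quotient_swap[OF simple_root_in[OF i], of \<mu>]
    by (simp add: i additive.minus[OF embed_additive] flip: simple_reflection_def)
  have "?T * X_elt H (?s \<mu>) = X_elt H \<mu> * ?T - scale H ?d (?q \<mu>)"
    using B[of "?s \<mu>"] unfolding swap unfolding simple_reflection_involution[OF i] by simp
  then show ?thesis
    unfolding distrib_left distrib_right B[of \<mu>] by simp
qed

lemma T_gen_commutes_symmetric:
  assumes "symmetric q" and i: "i \<in> index_set"
  shows "T_gen H i * embed q = embed q * T_gen H i"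
proof -
  let ?s = "simple_reflection D i" and ?T = "T_gen H i" and ?l = "Poly_Mapping.lookup q"
    and ?K = "Poly_Mapping.keys q"
  have inv: "?l (?s \<mu>) = ?l \<mu>" for \<mu>
    using assms by (simp add: symmetric_def)
  then have "?s \<mu> \<in> ?K \<longleftrightarrow> \<mu> \<in> ?K" for \<mu> by (simp add: in_keys_iff)
  then have "embed q = (\<Sum>\<mu>\<in>?K. scale H (?l \<mu>) (X_elt H (?s \<mu>)))"
    unfolding group_alg_embed_def
    by (intro sum.reindex_bij_witness[of _ ?s ?s]) (simp_all add: i inv)
  \<comment> \<open>Doubling treats exponents fixed by the reflection like all others, without
    choosing representatives of pairs; the factor 2 cancels at the end.\<close>
  then have "embed q + embed q = (\<Sum>\<mu>\<in>?K. scale H (?l \<mu>) (X_elt H \<mu> + X_elt H (?s \<mu>)))"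
    by (simp add: group_alg_embed_def scale_right_distrib sum.distrib)
  then have "?T * (embed q + embed q) = (embed q + embed q) * ?T"
    by (simp add: sum_distrib_left sum_distrib_right T_gen_commutes_orbit[OF i]
        flip: scale_mult_left scale_mult_right)
  then have "scale H 2 (?T * embed q - embed q * ?T) = 0"
    by (simp only: scale_left_distrib scale_one flip: one_add_one) (simp add: algebra_simps)
  then have "?T * embed q - embed q * ?T = 0"
    by (rule scale_torsion_free[rotated]) simp
  then show ?thesis by simp
qed

lemma eps0_commutes_symmetric:
  assumes "symmetric q"
  shows "eps0 D H * embed q = embed q * eps0 D H"
proof -
  have "prod_list (map (T_gen H) xs) * embed q = embed q * prod_list (map (T_gen H) xs)"
    if "xs \<in> words" for xs
    using that
  proof (induction xs)
    case (Cons i xs)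
    then have i: "i \<in> index_set"
      and IH: "prod_list (map (T_gen H) xs) * embed q = embed q * prod_list (map (T_gen H) xs)"
      by simp_all
    have "prod_list (map (T_gen H) (i # xs)) * embed q =
        T_gen H i * (embed q * prod_list (map (T_gen H) xs))"
      by (simp add: mult.assoc IH)
    also have "\<dots> = embed q * prod_list (map (T_gen H) (i # xs))"
      using T_gen_commutes_symmetric[OF assms i] by (simp flip: mult.assoc)
    finally show ?case .
  qed simp
  moreover have "\<exists>xs\<in>words. T_elt D H z = prod_list (map (T_gen H) xs)" if "z \<in> weyl_group D" for z
    using reduced_word_exists[OF that] T_elt_reduced unfolding reduced_word_iff_reduced reduced_def by metis
  ultimately have "T_elt D H z * embed q = embed q * T_elt D H z" if "z \<in> weyl_group D" for z
    using that by metis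
  then have "char_sum c * embed q = embed q * char_sum c" for c
    by (simp add: char_sum_def sum_distrib_left sum_distrib_right flip: scale_mult_left scale_mult_right)
  then show ?thesis
    by (simp add: eps0_eq flip: scale_mult_left scale_mult_right)
qed

subsection \<open>The elements \<open>A\<^sub>\<mu>\<close>\<close>

lemma A_elt_simple_reflection:
  assumes i: "i \<in> index_set"
  shows "A_elt D H (simple_reflection D i \<mu>) = - A_elt D H \<mu>"
proof -
  let ?s = "simple_reflection D i" and ?T = "T_gen H i" and ?\<epsilon> = "eps0 D H" and ?o = "one0 D H"
  let ?X = "X_elt H \<mu> + X_elt H (?s \<mu>)"
  let ?Y = "?\<epsilon> * ?X * ?o"
  have "scale H t_half ?Y = ?\<epsilon> * ?X * (?T * ?o)"
    by (simp add: T_gen_one0[OF i] scale_mult_right)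
  also have "\<dots> = ?\<epsilon> * (?X * ?T) * ?o"
    by (simp only: mult.assoc)
  also have "\<dots> = (?\<epsilon> * ?T) * ?X * ?o"
    by (simp only: T_gen_commutes_orbit[OF i, symmetric] mult.assoc)
  also have "\<dots> = scale H (- t_neg_half) ?Y"
    by (simp only: eps0_T_gen[OF i] scale_mult_left)
  finally have "scale H (t_half + t_neg_half) ?Y = 0"
    by (simp add: scale_left_distrib)
  \<comment> \<open>The difference of the two eigenvalues is nonzero, seen at its coefficient of
    t^(1/2).\<close>
  moreover have "Poly_Mapping.lookup (t_half + t_neg_half) 1 \<noteq> 0"
    by (simp add: t_half_def t_neg_half_def lookup_add lookup_single)
  then have "t_half + t_neg_half \<noteq> 0" by auto
  ultimately have "?Y = 0" using scale_torsion_free by blast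
  then show ?thesis
    by (simp add: A_elt_def algebra_simps eq_neg_iff_add_eq_0)
qed

lemma A_elt_weyl_group:
  assumes "w \<in> weyl_group D"
  shows "A_elt D H (w \<mu>) = scale H (of_int (lattice_det w)) (A_elt D H \<mu>)"
proof -
  have "\<forall>\<mu>. A_elt D H (w \<mu>) = scale H (of_int (lattice_det w)) (A_elt D H \<mu>)"
    using assms
  proof (induction rule: weyl_length_induct)
    case id
    show ?case unfolding lattice_det_id by simp
  next
    case (step v i)
    show ?case
    proof
      fix \<mu>
      have "A_elt D H (v (simple_reflection D i \<mu>)) =
          scale H (of_int (- lattice_det v)) (A_elt D H \<mu>)"
        using step.IH by (simp add: A_elt_simple_reflection[OF step(2)])
      then show "A_elt D H ((v \<circ> simple_reflection D i) \<mu>) =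
          scale H (of_int (lattice_det (v \<circ> simple_reflection D i))) (A_elt D H \<mu>)"
        unfolding lattice_det_simple[OF step(1,2)] by simp
    qed
  qed
  then show ?thesis ..
qed

text \<open>The determinant in the alternant meets the same sign from
  \<open>A_elt_weyl_group\<close>; their product is 1, so every \<open>w\<close> contributes
  equally.\<close>

lemma eps0_alternant_one0:
  "eps0 D H * embed (alternant \<nu>) * one0 D H =
    scale H (of_nat (card (weyl_group D))) (A_elt D H \<nu>)"
proof -
  have "embed (alternant \<nu>) = (\<Sum>w\<in>weyl_group D. scale H (of_int (lattice_det w)) (X_elt H (w \<nu>)))"
    by (simp add: alternant_def additive.sum[OF embed_additive] of_int_times_Xmon embed_single)
  then have "eps0 D H * embed (alternant \<nu>) * one0 D H =
      (\<Sum>w\<in>weyl_group D. scale H (of_int (lattice_det w)) (A_elt D H (w \<nu>)))"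
    by (simp add: sum_distrib_left sum_distrib_right A_elt_def flip: scale_mult_left scale_mult_right)
  also have "\<dots> = (\<Sum>w\<in>weyl_group D. A_elt D H \<nu>)"
    by (rule sum.cong)
      (simp_all add: A_elt_weyl_group lattice_det_square flip: of_int_mult)
  also have "\<dots> = scale H (of_nat (card (weyl_group D))) (A_elt D H \<nu>)"
    using scale_sum_left[of "\<lambda>_. 1" "weyl_group D" "A_elt D H \<nu>"] by simp
  finally show ?thesis .
qed

theorem casselman_shalika:
  assumes "lam \<in> dominant_weights D"
  shows "embed (weyl_character D lam) * A_elt D H (rho D) = A_elt D H (lam + rho D)"
proof -
  let ?s = "embed (weyl_character D lam)" and ?n = "of_nat (card (weyl_group D)) :: laurent"
  have "scale H ?n (?s * A_elt D H (rho D)) = ?s * (eps0 D H * embed (alternant (rho D)) * one0 D H)"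
    by (simp only: eps0_alternant_one0 scale_mult_right)
  also have "\<dots> = (?s * eps0 D H) * embed (alternant (rho D)) * one0 D H"
    by (simp only: mult.assoc)
  also have "\<dots> = eps0 D H * (?s * embed (alternant (rho D))) * one0 D H"
    by (simp only: eps0_commutes_symmetric[OF weyl_character(1)[OF assms], symmetric] mult.assoc)
  also have "\<dots> = scale H ?n (A_elt D H (lam + rho D))"
    by (simp only: weyl_character(2)[OF assms] eps0_alternant_one0 flip: embed_mult)
  finally have "scale H ?n (?s * A_elt D H (rho D) - A_elt D H (lam + rho D)) = 0"
    by (simp add: scale_right_diff_distrib)
  moreover have "card (weyl_group D) \<noteq> 0"
    using finite_weyl_group id_in_weyl_group by (metis card_eq_0_iff empty_iff)
  then have "?n \<noteq> 0" by simp
  ultimately have "?s * A_elt D H (rho D) - A_elt D H (lam + rho D) = 0"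
    using scale_torsion_free by blast
  then show ?thesis by simp
qed

end

theorem theorem2p3:
  fixes D :: "('x::ab_group_add, 'y::ab_group_add) root_datum"
    and H :: "('x, 'h::ring_1) hecke_data"
    and lam :: 'x
  assumes "based_root_datum D"
    and "\<exists>\<rho>. \<rho> + \<rho> = \<Sum>(positive_roots D)"
    and "affine_hecke_algebra D H"
    and "lam \<in> dominant_weights D"
  shows "group_alg_embed H (weyl_character D lam) * A_elt D H (rho D) = A_elt D H (lam + rho D)"
proof -
  interpret affine_hecke_algebra D H by fact
  interpret affine_hecke_algebra_rho D H
    by unfold_locales fact
  show ?thesis by (rule casselman_shalika) fact
qed

end
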